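(* Tile $\mathbb{R}^2$ by the closed unit squares $\{S_k\}_{k\ge 0}$ of the integer-translated grid whose centres are the points of $\mathbb{Z}^2$, with $S_0$ the square centred at the origin. Each square is either occupied or vacant. Let $C(0)$ be the occupied star-connected component containing $S_0$, and suppose $C(0)$ is finite. Let $G_C$ be the graph whose vertices are the corners of the squares of $C(0)$ and whose edges are the sides of the squares of $C(0)$, and let $\partial_0$ be the outermost boundary of $C(0)$, i.e. the set of edges $e$ of $G_C$ such that for every cycle $C$ in $G_C$, either $e$ is an edge of $C$ or $e$ lies in the exterior of $C$. Then $\partial_0$ is (the edge set of) a unique set of cycles $C_1,\dots,C_n$ in $G_C$ with the following properties: (i) the graph $\bigcup_{1\le i\le n} C_i$ is a connected subgraph of $G_C$; (ii) if $i\neq j$, the cycles $C_i$ and $C_j$ have disjoint interiors and share at most one vertex; (iii) every square $S_k\in C(0)$ is contained in the interior of some cycle $C_j$; (iv) if $e\in C_j$ for some $j$, then $e$ is a boundary edge of $C(0)$, adjacent to an occupied square of $C(0)$ lying in the interior of $C_j$ and adjacent to a vacant square lying in the exterior of $C_j$. Moreover, there exists a circuit $C_{out}$ containing every edge of $\bigcup_{1\le i\le n} C_i$.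
   Context: Two squares are star-adjacent (adjacent) if they share a corner, and plus-adjacent if they share an edge. $C(0)$ is empty if $S_0$ is vacant; otherwise it is the set of occupied squares $S$ such that there is a sequence of distinct occupied squares $S_0=Y_1,\dots,Y_t=S$ with $Y_i$ star-adjacent to $Y_{i+1}$ for all $i$. An edge $e$ is adjacent to a square if it is one of the sides of that square; $e$ is a boundary edge if it is adjacent to one vacant and one occupied square. A path is a sequence of distinct vertices with consecutive ones joined by an edge; a cycle is a sequence of distinct vertices $(v_0,\dots,v_m,v_0)$ with consecutive vertices (including $v_m,v_0$) joined by edges; a circuit is a closed sequence of vertices $(w_0,\dots,w_r,w_0)$ with consecutive vertices joined by edges and no edge repeated (vertices may repeat). A cycle divides the plane into two connected regions: the bounded one is its interior, the unbounded one its exterior. *)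

theory Defs
  imports "HOL-Analysis.Analysis"
begin

type_synonym pt = "real \<times> real"
type_synonym sqidx = "int \<times> int"

definition square :: "sqidx \<Rightarrow> pt set" where
  "square p = {(x, y). \<bar>x - real_of_int (fst p)\<bar> \<le> 1/2 \<and> \<bar>y - real_of_int (snd p)\<bar> \<le> 1/2}"

definition corners :: "sqidx \<Rightarrow> pt set" where
  "corners p = {(real_of_int (fst p) + s, real_of_int (snd p) + t) | s t. s \<in> {-1/2, 1/2} \<and> t \<in> {-1/2, 1/2}}"

definition sides :: "sqidx \<Rightarrow> pt set set" where
  "sides p = (let a = real_of_int (fst p); b = real_of_int (snd p); h = (1/2::real) in
     {{(a-h, b-h), (a+h, b-h)}, {(a+h, b-h), (a+h, b+h)},
      {(a+h, b+h), (a-h, b+h)}, {(a-h, b+h), (a-h, b-h)}})"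

text \<open>Star-adjacency: two (distinct) squares share a corner.\<close>
definition star_adj :: "sqidx \<Rightarrow> sqidx \<Rightarrow> bool" where
  "star_adj p q \<longleftrightarrow> p \<noteq> q \<and> \<bar>fst p - fst q\<bar> \<le> 1 \<and> \<bar>snd p - snd q\<bar> \<le> 1"

definition C0 :: "(sqidx \<Rightarrow> bool) \<Rightarrow> sqidx set" where
  "C0 occ = (if \<not> occ (0, 0) then {} else
     {s. occ s \<and> (\<exists>ys. ys \<noteq> [] \<and> distinct ys \<and> hd ys = (0, 0) \<and> last ys = s \<and>
            (\<forall>y\<in>set ys. occ y) \<and> (\<forall>i. Suc i < length ys \<longrightarrow> star_adj (ys ! i) (ys ! Suc i)))})"

definition GC_vertices :: "(sqidx \<Rightarrow> bool) \<Rightarrow> pt set" where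
  "GC_vertices occ = (\<Union>p\<in>C0 occ. corners p)"

definition GC_edges :: "(sqidx \<Rightarrow> bool) \<Rightarrow> pt set set" where
  "GC_edges occ = (\<Union>p\<in>C0 occ. sides p)"

definition closed_walk_edges :: "pt list \<Rightarrow> pt set set" where
  "closed_walk_edges vs = {{vs ! i, vs ! ((i + 1) mod length vs)} | i. i < length vs}"

definition is_cycle_list :: "pt set set \<Rightarrow> pt list \<Rightarrow> bool" where
  "is_cycle_list E vs \<longleftrightarrow> distinct vs \<and> 3 \<le> length vs \<and>
     (\<forall>i < length vs. {vs ! i, vs ! ((i + 1) mod length vs)} \<in> E)"

definition is_cycle :: "pt set set \<Rightarrow> pt set set \<Rightarrow> bool" where
  "is_cycle E K \<longleftrightarrow> (\<exists>vs. is_cycle_list E vs \<and> K = closed_walk_edges vs)"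

definition is_circuit_list :: "pt set set \<Rightarrow> pt list \<Rightarrow> bool" where
  "is_circuit_list E ws \<longleftrightarrow> ws \<noteq> [] \<and>
     (\<forall>i < length ws. {ws ! i, ws ! ((i + 1) mod length ws)} \<in> E) \<and>
     (\<forall>i < length ws. \<forall>j < length ws. i \<noteq> j \<longrightarrow>
        {ws ! i, ws ! ((i + 1) mod length ws)} \<noteq> {ws ! j, ws ! ((j + 1) mod length ws)})"

definition seg :: "pt set \<Rightarrow> pt set" where
  "seg e = convex hull e"

definition open_seg :: "pt set \<Rightarrow> pt set" where
  "open_seg e = convex hull e - e"

definition curve :: "pt set set \<Rightarrow> pt set" where
  "curve K = (\<Union>e\<in>K. seg e)"

definition cyc_interior :: "pt set set \<Rightarrow> pt set" where
  "cyc_interior K = inside (curve K)"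

definition cyc_exterior :: "pt set set \<Rightarrow> pt set" where
  "cyc_exterior K = outside (curve K)"

definition outer_boundary :: "(sqidx \<Rightarrow> bool) \<Rightarrow> pt set set" where
  "outer_boundary occ = {e \<in> GC_edges occ. \<forall>K. is_cycle (GC_edges occ) K \<longrightarrow>
      e \<in> K \<or> open_seg e \<subseteq> cyc_exterior K}"

definition edges_connected :: "pt set set \<Rightarrow> bool" where
  "edges_connected E \<longleftrightarrow> (\<forall>u\<in>\<Union>E. \<forall>v\<in>\<Union>E. (\<lambda>x y. {x, y} \<in> E)\<^sup>*\<^sup>* u v)"

end

theory Submission
  imports Defs "HOL-Library.Multiset"
begin

text \<open>
  Write \<open>U\<close> for the unbounded edge-connected component of the complement of \<open>C(0)\<close>, and let
  \<open>D\<^sub>1, \<dots>, D\<^sub>n\<close> be the edge-connected components of the finite set of squares \<open>- U\<close>. The cycles are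
  the boundaries \<open>\<partial>D\<^sub>i\<close>. Everything rests on planar duality mod 2: a finite set of lattice edges has
  even degree everywhere iff it is the boundary \<open>\<partial>A\<close> of some set \<open>A\<close> of squares. If
  \<open>\<partial>A \<subseteq> \<partial>(- U)\<close>, then \<open>A\<close> is constant on \<open>U\<close> and on each \<open>D\<^sub>i\<close>, so \<open>\<partial>A\<close> contains either all of
  \<open>\<partial>D\<^sub>i\<close> or none of it. Hence \<open>\<partial>D\<^sub>i\<close> is a minimal even edge set, i.e. a cycle; every cycle contained in
  \<open>\<partial>(- U)\<close> is one of the \<open>\<partial>D\<^sub>i\<close>, which is uniqueness; and if \<open>\<partial>D\<^sub>i\<close> and \<open>\<partial>D\<^sub>j\<close> shared two vertices,
  an arc of one together with an arc of the other would be an even edge set containing only part of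
  \<open>\<partial>D\<^sub>i\<close>. The same decomposition replaces the Jordan curve theorem: squares of \<open>D\<^sub>i\<close> cannot be left
  without crossing \<open>\<partial>D\<^sub>i\<close>, and the complement of \<open>D\<^sub>i\<close> is edge-connected and unbounded.
\<close>

section \<open>Cycles, arcs and circuits as lists of vertices\<close>

text \<open>A list rather than a set, so that repeated edges stay visible to \<open>distinct\<close>
  and \<open>mset\<close>. A closed walk is written as \<open>vs @ [hd vs]\<close>.\<close>

fun walk_edges :: "'a list \<Rightarrow> 'a set list" where
  "walk_edges (x # y # xs) = {x, y} # walk_edges (y # xs)"
| "walk_edges _ = []"

text \<open>For finite \<open>K\<close>, membership in the cycle space mod 2. A vertex of infinite
  degree would count as even, since \<open>card\<close> is 0 there.\<close>

definition even_graph :: "'a set set \<Rightarrow> bool" where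
  "even_graph K \<longleftrightarrow> (\<forall>v. even (card {e \<in> K. v \<in> e}))"

lemma walk_edges_append:
  "walk_edges (xs @ x # ys) = walk_edges (xs @ [x]) @ walk_edges (x # ys)"
proof (induction xs)
  case (Cons a xs)
  then show ?case by (cases xs) auto
qed simp

lemma length_walk_edges: "length (walk_edges xs) = length xs - 1"
  by (induction xs rule: walk_edges.induct) auto

lemma nth_walk_edges: "Suc i < length xs \<Longrightarrow> walk_edges xs ! i = {xs ! i, xs ! Suc i}"
proof (induction xs arbitrary: i rule: walk_edges.induct)
  case (1 x y xs)
  then show ?case by (cases i) auto
qed auto

lemma nth_closed_walk_edges:
  assumes "i < length vs"
  shows "walk_edges (vs @ [hd vs]) ! i = {vs ! i, vs ! ((i + 1) mod length vs)}"
proof (cases "Suc i < length vs")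
  case True
  then show ?thesis by (simp add: nth_walk_edges nth_append)
next
  case False
  with assms have "Suc i = length vs" by simp
  moreover have "hd vs = vs ! 0" using assms by (cases vs) auto
  ultimately show ?thesis by (simp add: nth_walk_edges nth_append)
qed

text \<open>Trades cyclic indexing for a list whose head is repeated at the end, so that list
  induction and \<open>walk_edges_append\<close> apply.\<close>

lemma closed_walk_edges_conv: "closed_walk_edges vs = set (walk_edges (vs @ [hd vs]))"
proof -
  have "set (walk_edges (vs @ [hd vs])) = {walk_edges (vs @ [hd vs]) ! i | i. i < length vs}"
    by (simp add: set_conv_nth length_walk_edges)
  also have "\<dots> = {{vs ! i, vs ! ((i + 1) mod length vs)} | i. i < length vs}"
    unfolding setcompr_eq_image by (rule image_cong) (simp_all add: nth_closed_walk_edges)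
  finally show ?thesis by (simp add: closed_walk_edges_def)
qed

lemma is_cycle_conv:
  "is_cycle E K \<longleftrightarrow> (\<exists>vs. distinct vs \<and> 3 \<le> length vs \<and> K = set (walk_edges (vs @ [hd vs])) \<and> K \<subseteq> E)"
  unfolding is_cycle_def is_cycle_list_def closed_walk_edges_conv[symmetric]
  by (auto simp: closed_walk_edges_def)

lemma is_circuit_list_conv:
  "is_circuit_list E ws \<longleftrightarrow>
     ws \<noteq> [] \<and> set (walk_edges (ws @ [hd ws])) \<subseteq> E \<and> distinct (walk_edges (ws @ [hd ws]))"
  unfolding is_circuit_list_def closed_walk_edges_conv[symmetric] distinct_conv_nth
  by (auto simp: closed_walk_edges_def length_walk_edges nth_closed_walk_edges)

text \<open>Rotating a closed walk permutes its edges. The multiset form transfers both the edge set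
  and the absence of repetitions.\<close>

lemma mset_walk_edges_rotate:
  "mset (walk_edges ((xs @ v # ys) @ [hd (xs @ v # ys)])) = mset (walk_edges (v # ys @ xs @ [v]))"
proof (cases xs)
  case (Cons x zs)
  have "walk_edges ((x # zs) @ v # (ys @ [x])) = walk_edges ((x # zs) @ [v]) @ walk_edges (v # ys @ [x])"
    using walk_edges_append[of "x # zs" v "ys @ [x]"] by simp
  moreover have "walk_edges ((v # ys) @ x # (zs @ [v])) = walk_edges ((v # ys) @ [x]) @ walk_edges (x # zs @ [v])"
    using walk_edges_append[of "v # ys" x "zs @ [v]"] by simp
  ultimately show ?thesis using Cons by simp
qed auto

lemma closed_walk_rotate:
  assumes "v \<in> set vs"
  obtains ys where "mset (v # ys) = mset vs"
    "mset (walk_edges (v # ys @ [v])) = mset (walk_edges (vs @ [hd vs]))"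
proof -
  obtain as bs where vs: "vs = as @ v # bs" using assms by (meson split_list)
  show thesis
    by (rule that[of "bs @ as"]) (use mset_walk_edges_rotate[of as v bs] vs in auto)
qed

lemma walk_edges_subset: "e \<in> set (walk_edges xs) \<Longrightarrow> e \<subseteq> set xs"
  by (induction xs rule: walk_edges.induct) auto

lemma Union_walk_edges: "2 \<le> length xs \<Longrightarrow> \<Union> (set (walk_edges xs)) = set xs"
proof (induction xs rule: walk_edges.induct)
  case (1 x y xs)
  then show ?case by (cases xs) auto
qed auto

section \<open>Degree parities of paths and cycles\<close>

lemma incident_insert: 
  "{f \<in> insert e K. v \<in> f} = (if v \<in> e then insert e {f \<in> K. v \<in> f} else {f \<in> K. v \<in> f})"
  by auto

text \<open>Prepending the edge \<open>{x, y}\<close> flips the parity at \<open>x\<close> and at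
  \<open>y\<close> only. The exclusive disjunction also covers a one-vertex path, whose two ends
  cancel.\<close>

lemma odd_degree_path:
  assumes "distinct xs" "xs \<noteq> []"
  shows "odd (card {e \<in> set (walk_edges xs). z \<in> e}) \<longleftrightarrow> (z = hd xs) \<noteq> (z = last xs)"
  using assms
proof (induction xs rule: walk_edges.induct)
  case (1 x y xs)
  have new: "{x, y} \<notin> set (walk_edges (y # xs))"
    using walk_edges_subset[of "{x, y}" "y # xs"] 1(2) by auto
  have IH: "odd (card {e \<in> set (walk_edges (y # xs)). z \<in> e}) \<longleftrightarrow> (z = y) \<noteq> (z = last (y # xs))"
    using 1 by auto
  have "x \<noteq> last (y # xs)" "x \<noteq> y" using 1(2) last_in_set[of "y # xs"] by (auto simp del: last.simps)
  moreover have "card {e \<in> set (walk_edges (x # y # xs)). z \<in> e} =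
      (if z = x \<or> z = y then 1 else 0) + card {e \<in> set (walk_edges (y # xs)). z \<in> e}"
    using new by (simp add: incident_insert[unfolded insert_iff])
  ultimately show ?case using IH by (auto simp del: walk_edges.simps)
qed auto

text \<open>The first edge is the only edge of the path at its first vertex, so an even subset must
  omit it; induction removes the others.\<close>

lemma even_subset_path_empty:
  assumes "distinct xs" "K \<subseteq> set (walk_edges xs)" "even_graph K"
  shows "K = {}"
  using assms
proof (induction xs rule: walk_edges.induct)
  case (1 x y xs)
  have "{x, y} \<notin> K"
  proof
    assume "{x, y} \<in> K"
    moreover have "e = {x, y}" if "e \<in> K" "x \<in> e" for e
      using that 1(2,3) walk_edges_subset[of e "y # xs"] by auto
    ultimately have "{e \<in> K. x \<in> e} = {{x, y}}" by blast
    then show False using 1(4) unfolding even_graph_def by (metis is_singletonI is_singleton_altdef odd_one)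
  qed
  then show ?case using 1 by auto
qed auto

text \<open>A cycle is a path with one closing edge. With only two vertices the closing edge would
  repeat the path edge; three vertices make it new.\<close>

lemma cycle_edges_split:
  assumes "distinct (v # ys)" "3 \<le> length (v # ys)"
  shows "set (walk_edges (v # ys @ [v])) = insert {last ys, v} (set (walk_edges (v # ys)))"
    "{last ys, v} \<notin> set (walk_edges (v # ys))"
proof -
  obtain zs l where ys: "ys = zs @ [l]" using assms by (cases ys rule: rev_cases) auto
  show "set (walk_edges (v # ys @ [v])) = insert {last ys, v} (set (walk_edges (v # ys)))"
    using walk_edges_append[of "v # zs" l "[v]"] ys by simp
  obtain z zs' where zs: "zs = z # zs'" using ys assms by (cases zs) auto
  then have "walk_edges (v # ys) = {v, z} # walk_edges (z # zs' @ [l])" using ys by simp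
  then show "{last ys, v} \<notin> set (walk_edges (v # ys))"
    using assms ys zs walk_edges_subset[of "{l, v}" "z # zs' @ [l]"] by (auto simp: doubleton_eq_iff)
qed

lemma is_cycle_startE:
  assumes "is_cycle E K" "v \<in> \<Union>K"
  obtains ys where "distinct (v # ys)" "3 \<le> length (v # ys)" "K = set (walk_edges (v # ys @ [v]))"
proof -
  obtain vs where vs: "distinct vs" "3 \<le> length vs" "K = set (walk_edges (vs @ [hd vs]))"
    using assms unfolding is_cycle_conv by auto
  have "v \<in> set (vs @ [hd vs])"
    using assms(2) walk_edges_subset[of _ "vs @ [hd vs]"] vs(3) by blast
  then have "v \<in> set vs" using vs(2) by (cases vs) auto
  from closed_walk_rotate[OF this] obtain ys where ys: "mset (v # ys) = mset vs"
    "mset (walk_edges (v # ys @ [v])) = mset (walk_edges (vs @ [hd vs]))" .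
  show thesis
  proof (rule that[of ys])
    show "distinct (v # ys)" using mset_eq_imp_distinct_iff[OF ys(1)] vs(1) by blast
    show "3 \<le> length (v # ys)" using mset_eq_length[OF ys(1)] vs(2) by simp
    show "K = set (walk_edges (v # ys @ [v]))" using mset_eq_setD[OF ys(2)] vs(3) by blast
  qed
qed

lemma is_cycle_nonempty: "is_cycle E K \<Longrightarrow> K \<noteq> {}"
  unfolding is_cycle_def is_cycle_list_def closed_walk_edges_def by fastforce

lemma is_cycle_has_vertex:
  assumes "is_cycle E K"
  obtains v where "v \<in> \<Union>K"
proof -
  obtain e where "e \<in> K" using is_cycle_nonempty[OF assms] by auto
  moreover from this have "e \<noteq> {}"
    using assms unfolding is_cycle_def closed_walk_edges_def by auto
  ultimately show thesis using that by auto
qed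

text \<open>The path through all vertices is odd exactly at its two ends, and the closing edge
  corrects both.\<close>

lemma is_cycle_even:
  assumes "is_cycle E K"
  shows "even_graph K"
  unfolding even_graph_def
proof
  fix z
  obtain vs where vs: "distinct vs" "3 \<le> length vs" "K = set (walk_edges (vs @ [hd vs]))"
    using assms unfolding is_cycle_conv by auto
  obtain v ys where vy: "vs = v # ys" using vs by (cases vs) auto
  have ne: "ys \<noteq> []" using vs vy by auto
  have lv: "last ys \<noteq> v" using vs(1) vy ne last_in_set by force
  note sp = cycle_edges_split[of v ys]
  have K: "K = insert {last ys, v} (set (walk_edges (v # ys)))" using sp(1) vs vy by simp
  have "odd (card {e \<in> set (walk_edges (v # ys)). z \<in> e}) \<longleftrightarrow> (z = v) \<noteq> (z = last ys)"
    using odd_degree_path[of "v # ys" z] vs(1) vy ne by simp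
  then show "even (card {e \<in> K. z \<in> e})"
    using sp(2) vs vy lv unfolding K incident_insert by auto
qed

text \<open>Minimality of cycles: a proper subset misses some edge, and a cycle without that edge is
  a path, which has no nonempty even subset.\<close>

lemma even_subset_cycle:
  assumes "is_cycle E K" "K' \<subseteq> K" "K' \<noteq> {}" "even_graph K'"
  shows "K' = K"
proof (rule ccontr)
  assume "K' \<noteq> K"
  then obtain e where e: "e \<in> K" "e \<notin> K'" using assms by auto
  obtain vs where vs: "distinct vs" "3 \<le> length vs" "K = set (walk_edges (vs @ [hd vs]))"
    using assms unfolding is_cycle_conv by auto
  obtain i where i: "i < length vs" "e = {vs ! i, vs ! ((i + 1) mod length vs)}"
    using e(1) vs(3) unfolding closed_walk_edges_conv[symmetric] closed_walk_edges_def by auto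
  \<comment> \<open>The cycle is rotated to make the missing edge \<open>e\<close> its first edge;
    the remaining path is \<open>zs @ [v]\<close>.\<close>
  define v where "v = vs ! i"
  have split: "vs = take i vs @ v # drop (Suc i) vs" using i(1) v_def id_take_nth_drop by blast
  define w where "w = vs ! ((i + 1) mod length vs)"
  define zs where "zs = drop (Suc i) vs @ take i vs"
  have m: "mset (v # zs) = mset vs"
    using arg_cong[OF split, of mset] unfolding zs_def by simp
  have K: "K = set (walk_edges (v # zs @ [v]))"
    using mset_walk_edges_rotate[of "take i vs" v "drop (Suc i) vs"] split vs(3)
    unfolding zs_def by (metis append.assoc set_mset_mset)
  have d: "distinct (v # zs)" "3 \<le> length (v # zs)"
    using m vs by (metis mset_eq_imp_distinct_iff, metis mset_eq_length)
  then have zne: "zs \<noteq> []" by auto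
  have w: "hd zs = w"
  proof (cases "Suc i < length vs")
    case True
    then show ?thesis unfolding zs_def w_def by (simp add: hd_append hd_drop_conv_nth)
  next
    case False
    then have "Suc i = length vs" using i by simp
    then show ?thesis using zne unfolding zs_def w_def by (auto simp: hd_conv_nth)
  qed
  have ee: "e = {v, hd zs}" using i w v_def w_def by simp
  have "walk_edges (v # zs @ [v]) = {v, hd zs} # walk_edges (zs @ [v])"
    using zne by (cases zs) auto
  then have "K' \<subseteq> set (walk_edges (zs @ [v]))" using K e ee assms(2) by auto
  then show False using even_subset_path_empty[of "zs @ [v]" K'] d assms by auto
qed

text \<open>Start the cycle at \<open>v\<close> and stop on reaching \<open>w\<close>; the parities
  are those of a path.\<close>

lemma cycle_arc:
  assumes "is_cycle E K" "v \<in> \<Union>K" "w \<in> \<Union>K" "v \<noteq> w"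
  obtains P where "P \<subseteq> K" "\<And>z. odd (card {e \<in> P. z \<in> e}) \<longleftrightarrow> z = v \<or> z = w"
proof -
  obtain ys where ys: "distinct (v # ys)" "3 \<le> length (v # ys)" "K = set (walk_edges (v # ys @ [v]))"
    using is_cycle_startE[OF assms(1,2)] .
  have "w \<in> set ys"
    using assms(3,4) ys(3) walk_edges_subset[of _ "v # ys @ [v]"] by fastforce
  then obtain as bs where ab: "ys = as @ w # bs" by (meson split_list)
  show thesis
  proof (rule that[of "set (walk_edges (v # as @ [w]))"])
    show "set (walk_edges (v # as @ [w])) \<subseteq> K"
      using walk_edges_append[of "v # as" w "bs @ [v]"] ys(3) ab by auto
    show "odd (card {e \<in> set (walk_edges (v # as @ [w])). z \<in> e}) \<longleftrightarrow> z = v \<or> z = w" for z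
      using odd_degree_path[of "v # as @ [w]" z] ys(1) ab assms(4) by auto
  qed
qed

lemma walk_connected:
  assumes "set (walk_edges (x # xs)) \<subseteq> E" "y \<in> set (x # xs)"
  shows "(\<lambda>a b. {a, b} \<in> E)\<^sup>*\<^sup>* x y"
  using assms
proof (induction xs arbitrary: x)
  case (Cons z zs)
  then have "y = x \<or> (\<lambda>a b. {a, b} \<in> E)\<^sup>*\<^sup>* z y" "{x, z} \<in> E" by auto
  then show ?case by (auto intro: converse_rtranclp_into_rtranclp)
qed auto

lemma is_cycle_connected:
  assumes "is_cycle E K" "u \<in> \<Union>K" "v \<in> \<Union>K" "K \<subseteq> F"
  shows "(\<lambda>a b. {a, b} \<in> F)\<^sup>*\<^sup>* u v"
proof -
  obtain ys where ys: "distinct (u # ys)" "3 \<le> length (u # ys)" "K = set (walk_edges (u # ys @ [u]))"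
    using is_cycle_startE[OF assms(1,2)] .
  have "v \<in> set (u # ys @ [u])"
    using assms(3) ys(3) walk_edges_subset[of _ "u # ys @ [u]"] by blast
  then show ?thesis using walk_connected[of u "ys @ [u]" F v] assms(4) ys(3) by auto
qed

lemma even_graph_contains_cycle:
  assumes fin: "finite K" and ne: "K \<noteq> {}" and ev: "even_graph K" and two: "\<And>e. e \<in> K \<Longrightarrow> card e = 2"
  obtains Z where "is_cycle K Z"
proof -
  \<comment> \<open>At least one edge is demanded: then all vertices of the path lie in
    \<open>\<Union>K\<close>, which bounds its length, and the first vertex has a successor.\<close>
  define paths where "paths = {xs. distinct xs \<and> 2 \<le> length xs \<and> set (walk_edges xs) \<subseteq> K}"
  have finU: "finite (\<Union>K)"
    using fin two by (metis card.infinite finite_Union zero_neq_numeral)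
  have sub: "set xs \<subseteq> \<Union>K" if "xs \<in> paths" for xs
    using that Union_walk_edges[of xs] unfolding paths_def by auto
  have bound: "length xs \<le> card (\<Union>K)" if "xs \<in> paths" for xs
  proof -
    have "length xs = card (set xs)" using that unfolding paths_def by (simp add: distinct_card)
    also have "\<dots> \<le> card (\<Union>K)" using sub[OF that] finU by (simp add: card_mono)
    finally show ?thesis .
  qed
  obtain e where e: "e \<in> K" using ne by auto
  obtain a b where ab: "e = {a, b}" "a \<noteq> b" using two[OF e] by (meson card_2_iff)
  have "[a, b] \<in> paths" using ab e unfolding paths_def by auto
  then obtain xs where xs: "xs \<in> paths" "\<And>ys. ys \<in> paths \<Longrightarrow> length ys \<le> length xs"
    using ex_has_greatest_nat[of "\<lambda>xs. xs \<in> paths" "[a, b]" length] bound by (metis less_Suc_eq_le)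
  \<comment> \<open>The first vertex of a longest path has a second edge, which must lead back into the path.\<close>
  obtain x y zs where xyz: "xs = x # y # zs"
    using xs(1) unfolding paths_def by (cases xs rule: walk_edges.cases) auto
  have xy: "{x, y} \<in> K" "x \<noteq> y" using xs(1) xyz unfolding paths_def by auto
  have "{e \<in> K. x \<in> e} \<noteq> {{x, y}}"
    using ev unfolding even_graph_def by (metis is_singletonI is_singleton_altdef odd_one)
  then obtain f where f: "f \<in> K" "x \<in> f" "f \<noteq> {x, y}" using xy by auto
  obtain w where w: "f = {x, w}" "w \<noteq> x" using two[OF f(1)] f(2) by (auto simp: card_2_iff)
  have wy: "w \<noteq> y" using f w by auto
  have "w \<in> set xs"
  proof (rule ccontr)
    assume "w \<notin> set xs"
    then have "w # xs \<in> paths"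
      using xs(1) xyz f w unfolding paths_def by (auto simp: insert_commute)
    then show False using xs(2) by fastforce
  qed
  then have "w \<in> set zs" using xyz w wy by auto
  then obtain as bs where ab: "zs = as @ w # bs" by (meson split_list)
  \<comment> \<open>Since \<open>w\<close> differs from \<open>x\<close> and \<open>y\<close>, this
    piece of the path has at least three vertices, and \<open>f = {x, w}\<close> closes it.\<close>
  define c where "c = x # y # as @ [w]"
  have "xs = c @ bs" unfolding c_def using xyz ab by simp
  then have dc: "distinct c" "3 \<le> length c" using xs(1) unfolding paths_def c_def by auto
  have "walk_edges xs = walk_edges c @ walk_edges (w # bs)"
    using walk_edges_append[of "x # y # as" w bs] xyz ab c_def by simp
  then have "set (walk_edges c) \<subseteq> K" using xs(1) unfolding paths_def by auto
  moreover have "walk_edges (c @ [hd c]) = walk_edges c @ [{w, x}]"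
    unfolding c_def using walk_edges_append[of "x # y # as" w "[x]"] by simp
  ultimately have "set (walk_edges (c @ [hd c])) \<subseteq> K" using f w by (simp add: insert_commute)
  then show thesis using that dc unfolding is_cycle_conv by blast
qed

text \<open>As for Euler circuits: edge-disjoint closed walks through a common vertex can be
  spliced, and connectedness supplies such a vertex as long as some cycle is missing.\<close>

lemma circuit_of_connected_cycles:
  assumes fin: "finite F" and ne: "F \<noteq> {}" and cyc: "\<And>K. K \<in> F \<Longrightarrow> is_cycle E K"
    and disj: "\<And>K K'. K \<in> F \<Longrightarrow> K' \<in> F \<Longrightarrow> K \<noteq> K' \<Longrightarrow> K \<inter> K' = {}"
    and conn: "edges_connected (\<Union>F)"
  obtains ws where "is_circuit_list E ws" "closed_walk_edges ws = \<Union>F"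
proof -
  \<comment> \<open>A subfamily covered exactly by one circuit. One of greatest size is shown to be
    all of \<open>F\<close>.\<close>
  define good where "good G \<longleftrightarrow> G \<noteq> {} \<and> G \<subseteq> F \<and>
    (\<exists>ws. is_circuit_list E ws \<and> closed_walk_edges ws = \<Union>G)" for G
  \<comment> \<open>Each edge of a path contains a vertex that does not recur later, and the closing
    edge is new.\<close>
  have cyc_circ: "is_circuit_list E (v # ys)"
    if d: "distinct (v # ys)" "3 \<le> length (v # ys)" "set (walk_edges (v # ys @ [v])) \<subseteq> E" for v ys
  proof -
    obtain zs l where ys: "ys = zs @ [l]" using d by (cases ys rule: rev_cases) auto
    have "distinct (walk_edges xs)" if "distinct xs" for xs :: "pt list"
      using that
    proof (induction xs rule: walk_edges.induct)
      case (1 x y xs)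
      then show ?case using walk_edges_subset[of "{x, y}" "y # xs"] by auto
    qed auto
    moreover have "walk_edges (v # ys @ [v]) = walk_edges (v # ys) @ [{last ys, v}]"
      using walk_edges_append[of "v # zs" l "[v]"] ys by simp
    ultimately show ?thesis
      unfolding is_circuit_list_conv using d cycle_edges_split(2)[of v ys] by auto
  qed
  obtain K0 where K0: "K0 \<in> F" using ne by auto
  obtain v0 where "v0 \<in> \<Union>K0" using is_cycle_has_vertex[OF cyc[OF K0]] .
  then obtain ys where ys: "distinct (v0 # ys)" "3 \<le> length (v0 # ys)" "K0 = set (walk_edges (v0 # ys @ [v0]))"
    using is_cycle_startE[OF cyc[OF K0]] by blast
  have "good {K0}"
    unfolding good_def using K0 ys cyc_circ[OF ys(1,2)] cyc[OF K0]
    by (intro conjI exI[of _ "v0 # ys"]) (auto simp: closed_walk_edges_conv is_cycle_conv)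
  moreover have "card G \<le> card F" if "good G" for G
    using that fin unfolding good_def by (simp add: card_mono)
  ultimately obtain G where G: "good G" "\<And>H. good H \<Longrightarrow> card H \<le> card G"
    using ex_has_greatest_nat[of good "{K0}" card] by (metis less_Suc_eq_le)
  have GF: "G \<subseteq> F" "G \<noteq> {}" using G(1) unfolding good_def by auto
  obtain ws where ws: "is_circuit_list E ws" "closed_walk_edges ws = \<Union>G"
    using G(1) unfolding good_def by auto
  have "G = F"
  proof (rule ccontr)
    assume "G \<noteq> F"
    then obtain K' where K': "K' \<in> F" "K' \<notin> G" using GF by auto
    obtain K1 where K1: "K1 \<in> G" using GF by auto
    obtain a where a: "a \<in> \<Union>K1" using is_cycle_has_vertex[OF cyc[of K1]] K1 GF by blast
    obtain b where b: "b \<in> \<Union>K'" using is_cycle_has_vertex[OF cyc[OF K'(1)]] .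
    have ab: "(\<lambda>x y. {x, y} \<in> \<Union>F)\<^sup>*\<^sup>* a b"
      using conn a b K1 K' GF unfolding edges_connected_def by blast
    \<comment> \<open>Otherwise a walk in \<open>\<Union>F\<close> that starts at a vertex covered
      by \<open>G\<close> could never leave those vertices, yet one leads from \<open>a\<close> to
      \<open>b\<close>.\<close>
    have "\<exists>v K. v \<in> \<Union>(\<Union>G) \<and> v \<in> \<Union>K \<and> K \<in> F - G"
    proof (rule ccontr)
      assume no: "\<nexists>v K. v \<in> \<Union>(\<Union>G) \<and> v \<in> \<Union>K \<and> K \<in> F - G"
      from ab have "b \<in> \<Union>(\<Union>G)"
      proof (induction rule: rtranclp_induct)
        case base
        then show ?case using a K1 by auto
      next
        case (step y z)
        then obtain K where "K \<in> F" "{y, z} \<in> K" by auto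
        then show ?case using no step by blast
      qed
      then show False using no b K' by blast
    qed
    then obtain v K where v: "v \<in> \<Union>(\<Union>G)" "v \<in> \<Union>K" and K: "K \<in> F" "K \<notin> G" by blast
    obtain ys where ys: "distinct (v # ys)" "3 \<le> length (v # ys)" "K = set (walk_edges (v # ys @ [v]))"
      using is_cycle_startE[OF cyc[OF K(1)] v(2)] .
    have wsne: "ws \<noteq> []" using ws(1) unfolding is_circuit_list_def by simp
    have "v \<in> set (ws @ [hd ws])"
      using v(1) walk_edges_subset[of _ "ws @ [hd ws]"]
      unfolding ws(2)[symmetric] closed_walk_edges_conv by blast
    then have "v \<in> set ws" using wsne by (cases ws) auto
    from closed_walk_rotate[OF this] obtain zs where zs: "mset (v # zs) = mset ws"
      "mset (walk_edges (v # zs @ [v])) = mset (walk_edges (ws @ [hd ws]))" .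
    have set_zs: "set (walk_edges (v # zs @ [v])) = \<Union>G"
      using zs(2) ws(2) unfolding closed_walk_edges_conv by (metis mset_eq_setD)
    have dz: "distinct (walk_edges (v # zs @ [v]))"
      using zs(2) ws(1) mset_eq_imp_distinct_iff unfolding is_circuit_list_conv by metis
    \<comment> \<open>Run through the old circuit from \<open>v\<close> back to \<open>v\<close>,
      then around \<open>K\<close>.\<close>
    define ws' where "ws' = v # zs @ v # ys"
    have we: "walk_edges (ws' @ [hd ws']) = walk_edges (v # zs @ [v]) @ walk_edges (v # ys @ [v])"
      unfolding ws'_def using walk_edges_append[of "v # zs" v "ys @ [v]"] by simp
    have "\<Union>G \<inter> K = {}" using disj K GF by blast
    moreover have KE: "K \<subseteq> E" using cyc[OF K(1)] unfolding is_cycle_conv by auto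
    moreover have "\<Union>G \<subseteq> E" using cyc GF unfolding is_cycle_conv by blast
    moreover have "distinct (walk_edges (v # ys @ [v]))"
      using cyc_circ[OF ys(1,2)] KE ys(3) unfolding is_circuit_list_conv by auto
    ultimately have "is_circuit_list E ws'"
      unfolding is_circuit_list_conv we using dz set_zs ys(3) by (auto simp: ws'_def)
    moreover have "closed_walk_edges ws' = \<Union>(insert K G)"
      unfolding closed_walk_edges_conv we using set_zs ys(3) by auto
    ultimately have "good (insert K G)" unfolding good_def using K GF by blast
    then have "card (insert K G) \<le> card G" using G(2) by blast
    then show False using K finite_subset[OF GF(1) fin] by auto
  qed
  then show thesis using that ws by blast
qed

section \<open>Boundaries of sets of squares\<close>

text \<open>Lower left corner, lower side and left side of the square with index \<open>(i, j)\<close>.\<close>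

definition lattice_pt :: "int \<Rightarrow> int \<Rightarrow> pt" where
  "lattice_pt i j = (real_of_int i - 1/2, real_of_int j - 1/2)"

definition hedge :: "int \<Rightarrow> int \<Rightarrow> pt set" where
  "hedge i j = {lattice_pt i j, lattice_pt (i + 1) j}"

definition vedge :: "int \<Rightarrow> int \<Rightarrow> pt set" where
  "vedge i j = {lattice_pt i j, lattice_pt i (j + 1)}"

definition lattice_edges :: "pt set set" where
  "lattice_edges = (\<Union>p. sides p)"

text \<open>The \<partial>A of the overview: the edges across which membership in \<open>A\<close>
  changes.\<close>

definition sq_boundary :: "sqidx set \<Rightarrow> pt set set" where
  "sq_boundary A = {e. \<exists>p q. p \<in> A \<and> q \<notin> A \<and> e \<in> sides p \<and> e \<in> sides q}"

definition plus_adj :: "sqidx \<Rightarrow> sqidx \<Rightarrow> bool" where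
  "plus_adj p q \<longleftrightarrow> p \<noteq> q \<and> sides p \<inter> sides q \<noteq> {}"

text \<open>Reflexive also at squares outside \<open>W\<close>; hence the premise
  \<open>p \<in> W\<close> in \<open>plus_conn_in\<close>.\<close>

definition plus_conn :: "sqidx set \<Rightarrow> sqidx \<Rightarrow> sqidx \<Rightarrow> bool" where
  "plus_conn W = (\<lambda>p q. p \<in> W \<and> q \<in> W \<and> plus_adj p q)\<^sup>*\<^sup>*"

section \<open>Lattice edges in integer coordinates\<close>

lemma lattice_pt_eq_iff [simp]: "lattice_pt i j = lattice_pt k l \<longleftrightarrow> i = k \<and> j = l"
  by (auto simp: lattice_pt_def)

lemma hedge_eq_iff [simp]: "hedge i j = hedge k l \<longleftrightarrow> i = k \<and> j = l"
  by (auto simp: hedge_def doubleton_eq_iff)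

lemma vedge_eq_iff [simp]: "vedge i j = vedge k l \<longleftrightarrow> i = k \<and> j = l"
  by (auto simp: vedge_def doubleton_eq_iff)

lemma hedge_neq_vedge [simp]: "hedge i j \<noteq> vedge k l" "vedge k l \<noteq> hedge i j"
  by (auto simp: vedge_def hedge_def doubleton_eq_iff)

lemma lattice_pt_in_hedge [simp]: "lattice_pt k l \<in> hedge i j \<longleftrightarrow> l = j \<and> (k = i \<or> k = i + 1)"
  by (auto simp: hedge_def)

lemma lattice_pt_in_vedge [simp]: "lattice_pt k l \<in> vedge i j \<longleftrightarrow> k = i \<and> (l = j \<or> l = j + 1)"
  by (auto simp: vedge_def)

lemma sides_conv:
  "sides p = {hedge (fst p) (snd p), hedge (fst p) (snd p + 1),
              vedge (fst p) (snd p), vedge (fst p + 1) (snd p)}"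
proof -
  have "lattice_pt (fst p) (snd p) = (real_of_int (fst p) - 1/2, real_of_int (snd p) - 1/2)"
    "lattice_pt (fst p + 1) (snd p) = (real_of_int (fst p) + 1/2, real_of_int (snd p) - 1/2)"
    "lattice_pt (fst p) (snd p + 1) = (real_of_int (fst p) - 1/2, real_of_int (snd p) + 1/2)"
    "lattice_pt (fst p + 1) (snd p + 1) = (real_of_int (fst p) + 1/2, real_of_int (snd p) + 1/2)"
    by (auto simp: lattice_pt_def)
  then show ?thesis
    unfolding sides_def Let_def hedge_def vedge_def by (auto simp: insert_commute)
qed

lemma hedge_in_sides: "hedge i j \<in> sides p \<longleftrightarrow> p = (i, j) \<or> p = (i, j - 1)"
  by (cases p) (auto simp: sides_conv)

lemma vedge_in_sides: "vedge i j \<in> sides p \<longleftrightarrow> p = (i, j) \<or> p = (i - 1, j)"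
  by (cases p) (auto simp: sides_conv)

lemma lattice_edge_cases:
  assumes "e \<in> lattice_edges"
  obtains i j where "e = hedge i j" | i j where "e = vedge i j"
  using assms by (auto simp: lattice_edges_def sides_conv)

lemma hedge_in_lattice_edges [simp]: "hedge i j \<in> lattice_edges"
  unfolding lattice_edges_def by (rule UN_I[of "(i, j)"]) (simp_all add: hedge_in_sides)

lemma vedge_in_lattice_edges [simp]: "vedge i j \<in> lattice_edges"
  unfolding lattice_edges_def by (rule UN_I[of "(i, j)"]) (simp_all add: vedge_in_sides)

lemma sides_subset_lattice_edges: "sides p \<subseteq> lattice_edges"
  by (auto simp: lattice_edges_def)

lemma card_lattice_edge: "e \<in> lattice_edges \<Longrightarrow> card e = 2"
  by (erule lattice_edge_cases) (auto simp: hedge_def vedge_def)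

text \<open>By coordinates, \<open>hedge i j\<close> bounds only \<open>(i, j)\<close> and
  \<open>(i, j - 1)\<close>, and \<open>vedge i j\<close> only \<open>(i, j)\<close> and
  \<open>(i - 1, j)\<close>.\<close>

lemma sides_unique:
  assumes "e \<in> sides p" "e \<in> sides q" "p \<noteq> q" "e \<in> sides r"
  shows "r = p \<or> r = q"
proof -
  have "e \<in> lattice_edges" using assms sides_subset_lattice_edges by blast
  then show ?thesis
    using assms by (cases rule: lattice_edge_cases) (auto simp: hedge_in_sides vedge_in_sides)
qed

lemma sq_boundary_subset: "sq_boundary A \<subseteq> lattice_edges"
  by (auto simp: sq_boundary_def lattice_edges_def)

lemma hedge_in_boundary: "hedge i j \<in> sq_boundary A \<longleftrightarrow> ((i, j) \<in> A) \<noteq> ((i, j - 1) \<in> A)"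
  unfolding sq_boundary_def by (auto simp: hedge_in_sides)

lemma vedge_in_boundary: "vedge i j \<in> sq_boundary A \<longleftrightarrow> ((i, j) \<in> A) \<noteq> ((i - 1, j) \<in> A)"
  unfolding sq_boundary_def by (auto simp: vedge_in_sides)

lemma finite_sides: "finite (sides p)"
  by (simp add: sides_conv)

lemma finite_sq_boundary: "finite A \<Longrightarrow> finite (sq_boundary A)"
  by (rule finite_subset[of _ "\<Union>p\<in>A. sides p"]) (auto simp: sq_boundary_def finite_sides)

text \<open>The upper side of a topmost square of \<open>A\<close> separates it from a square
  outside \<open>A\<close>.\<close>

lemma sq_boundary_nonempty:
  assumes "finite A" "A \<noteq> {}"
  shows "sq_boundary A \<noteq> {}"
proof -
  have "Max (snd ` A) \<in> snd ` A" using assms by (intro Max_in) auto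
  then obtain m where m: "m \<in> A" "snd m = Max (snd ` A)" by auto
  have max: "snd p \<le> snd m" if "p \<in> A" for p using assms that m(2) by simp
  have "(fst m, snd m + 1) \<notin> A" using max[of "(fst m, snd m + 1)"] by auto
  then have "hedge (fst m) (snd m + 1) \<in> sq_boundary A" using m(1) by (simp add: hedge_in_boundary)
  then show ?thesis by auto
qed

section \<open>Planar duality mod 2\<close>

lemma odd_card_filter_insert:
  assumes "a \<notin> S" "finite S"
  shows "odd (card {e \<in> insert a S. P e}) \<longleftrightarrow> P a \<noteq> odd (card {e \<in> S. P e})"
proof -
  have "{e \<in> insert a S. P e} = (if P a then insert a {e \<in> S. P e} else {e \<in> S. P e})" by auto
  then show ?thesis using assms by auto
qed

text \<open>Four lattice edges meet at the point. Inequality of truth values is addition mod 2, here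
  with the horizontal pair set against the vertical pair.\<close>

lemma even_degree_lattice_pt:
  assumes "K \<subseteq> lattice_edges"
  shows "even (card {e \<in> K. lattice_pt i j \<in> e}) \<longleftrightarrow>
    ((hedge (i - 1) j \<in> K) \<noteq> (hedge i j \<in> K)) = ((vedge i (j - 1) \<in> K) \<noteq> (vedge i j \<in> K))"
proof -
  have "{e \<in> K. lattice_pt i j \<in> e} =
      {e \<in> {hedge (i - 1) j, hedge i j, vedge i (j - 1), vedge i j}. e \<in> K}"
  proof (intro equalityI subsetI)
    fix e assume "e \<in> {e \<in> K. lattice_pt i j \<in> e}"
    then have e: "e \<in> K" "lattice_pt i j \<in> e" "e \<in> lattice_edges" using assms by auto
    from e(3) show "e \<in> {e \<in> {hedge (i - 1) j, hedge i j, vedge i (j - 1), vedge i j}. e \<in> K}"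
      using e(1,2) by (cases rule: lattice_edge_cases) auto
  qed auto
  moreover have "odd (card {e \<in> {hedge (i - 1) j, hedge i j, vedge i (j - 1), vedge i j}. e \<in> K}) \<longleftrightarrow>
      ((hedge (i - 1) j \<in> K) \<noteq> (hedge i j \<in> K)) \<noteq> ((vedge i (j - 1) \<in> K) \<noteq> (vedge i j \<in> K))"
    using odd_card_filter_insert[of "hedge (i - 1) j" "{hedge i j, vedge i (j - 1), vedge i j}" "\<lambda>e. e \<in> K"]
      odd_card_filter_insert[of "hedge i j" "{vedge i (j - 1), vedge i j}" "\<lambda>e. e \<in> K"]
      odd_card_filter_insert[of "vedge i (j - 1)" "{vedge i j}" "\<lambda>e. e \<in> K"]
      odd_card_filter_insert[of "vedge i j" "{}" "\<lambda>e. e \<in> K"]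
    by auto
  ultimately show ?thesis by auto
qed

lemma even_graph_lattice:
  assumes "K \<subseteq> lattice_edges"
  shows "even_graph K \<longleftrightarrow> (\<forall>i j.
    ((hedge (i - 1) j \<in> K) \<noteq> (hedge i j \<in> K)) = ((vedge i (j - 1) \<in> K) \<noteq> (vedge i j \<in> K)))"
proof -
  have "{e \<in> K. v \<in> e} = {}" if "\<nexists>i j. v = lattice_pt i j" for v
  proof -
    have "v \<notin> e" if "e \<in> lattice_edges" for e
      using that \<open>\<nexists>i j. v = lattice_pt i j\<close>
      by (cases rule: lattice_edge_cases) (auto simp: hedge_def vedge_def)
    then show ?thesis using assms by blast
  qed
  then have "even_graph K \<longleftrightarrow> (\<forall>i j. even (card {e \<in> K. lattice_pt i j \<in> e}))"
    unfolding even_graph_def by (metis card.empty even_zero)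
  then show ?thesis using even_degree_lattice_pt[OF assms] by simp
qed

text \<open>Going once around a lattice point through its four squares, membership in
  \<open>A\<close> changes an even number of times.\<close>

lemma even_sq_boundary: "even_graph (sq_boundary A)"
  unfolding even_graph_lattice[OF sq_boundary_subset] hedge_in_boundary vedge_in_boundary
  by auto

lemma even_graph_is_boundary:
  assumes fin: "finite K" and lat: "K \<subseteq> lattice_edges" and ev: "even_graph K"
  obtains A where "sq_boundary A = K"
proof -
  \<comment> \<open>A square belongs to \<open>A\<close> iff the downward vertical ray from its centre crosses \<open>K\<close> an odd number of
    times; evenness of \<open>K\<close> at the lattice points makes the vertical edges agree, going up from below \<open>K\<close>.\<close>
  define below where "below i j = {k. k \<le> j \<and> hedge i k \<in> K}" for i j
  define A where "A = {(i, j). odd (card (below i j))}"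
  have "finite {k. hedge i k \<in> K}" for i
    using finite_vimageI[OF fin, of "hedge i"] by (simp add: inj_def vimage_def)
  then have fb: "finite (below i j)" for i j
    by (rule finite_subset[rotated]) (auto simp: below_def)
  \<comment> \<open>Moving up one square lengthens the ray by exactly the crossing at
    \<open>hedge i j\<close>.\<close>
  have horiz: "(i, j) \<in> A \<longleftrightarrow> ((i, j - 1) \<in> A) \<noteq> (hedge i j \<in> K)" for i j
  proof -
    have "below i j = (if hedge i j \<in> K then insert j (below i (j - 1)) else below i (j - 1))"
      unfolding below_def using order.order_iff_strict by force
    moreover have "j \<notin> below i (j - 1)" by (simp add: below_def)
    ultimately show ?thesis using fb by (auto simp: A_def)
  qed
  have "finite {k. hedge i k \<in> K \<or> vedge i' k \<in> K \<or> hedge i'' k \<in> K}" for i i' i''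
  proof -
    have "finite (hedge i -` K)" "finite (vedge i' -` K)" "finite (hedge i'' -` K)"
      by (auto intro!: finite_vimageI[OF fin] simp: inj_def)
    then have "finite (hedge i -` K \<union> vedge i' -` K \<union> hedge i'' -` K)" by blast
    then show ?thesis by (rule finite_subset[rotated]) auto
  qed
  then have low: "\<exists>L. \<forall>k<L. hedge i k \<notin> K \<and> vedge i' k \<notin> K \<and> hedge i'' k \<notin> K" for i i' i''
    by (metis (mono_tags, lifting) mem_Collect_eq bdd_below_finite bdd_below.E not_le)
  have vert: "vedge i j \<in> K \<longleftrightarrow> ((i, j) \<in> A) \<noteq> ((i - 1, j) \<in> A)" for i j
  proof -
    obtain L where L: "\<And>k. k < L \<Longrightarrow> hedge i k \<notin> K \<and> vedge i k \<notin> K \<and> hedge (i - 1) k \<notin> K"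
      using low by blast
    \<comment> \<open>Below \<open>L\<close> both rays cross nothing and \<open>K\<close> has no
      vertical edge between the two columns. Row \<open>L - 1\<close> thus starts the upward
      induction.\<close>
    have far_below: "vedge i k \<in> K \<longleftrightarrow> ((i, k) \<in> A) \<noteq> ((i - 1, k) \<in> A)" if "k < L" for k
    proof -
      have "below i k = {}" "below (i - 1) k = {}" using L that by (auto simp: below_def)
      then show ?thesis using L that by (simp add: A_def)
    qed
    show ?thesis
    proof (cases "j < L")
      case False
      then have "L - 1 \<le> j" by simp
      then show ?thesis
      proof (induction j rule: int_ge_induct)
        case base
        then show ?case using far_below[of "L - 1"] by simp
      next
        case (step j)
        \<comment> \<open>Evenness at \<open>lattice_pt i (j + 1)\<close>. Together with
          \<open>horiz\<close> in both columns, the two sides of the claim change simultaneously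
          from row \<open>j\<close> to row \<open>j + 1\<close>.\<close>
        have "((hedge (i - 1) (j + 1) \<in> K) \<noteq> (hedge i (j + 1) \<in> K)) =
            ((vedge i j \<in> K) \<noteq> (vedge i (j + 1) \<in> K))"
          using ev unfolding even_graph_lattice[OF lat] by (metis add_diff_cancel_right')
        then show ?case using step.IH horiz[of i "j + 1"] horiz[of "i - 1" "j + 1"] by auto
      qed
    qed (rule far_below)
  qed
  have "e \<in> sq_boundary A \<longleftrightarrow> e \<in> K" if "e \<in> lattice_edges" for e
    using that
  proof (cases rule: lattice_edge_cases)
    case (1 i j)
    then show ?thesis using horiz[of i j] by (auto simp: hedge_in_boundary)
  next
    case (2 i j)
    then show ?thesis using vert[of i j] by (simp add: vedge_in_boundary)
  qed
  then have "sq_boundary A = K" using lat sq_boundary_subset by blast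
  then show thesis by (rule that)
qed

section \<open>Edge-connected sets of squares and the exterior region\<close>

lemma plus_adj_iff: "plus_adj (i, j) (k, l) \<longleftrightarrow> (i = k \<and> \<bar>j - l\<bar> = 1) \<or> (j = l \<and> \<bar>i - k\<bar> = 1)"
  unfolding plus_adj_def by (auto simp: sides_conv)

lemma plus_adj_sym: "plus_adj p q \<Longrightarrow> plus_adj q p"
  by (auto simp: plus_adj_def)

lemma plus_conn_refl [simp]: "plus_conn W p p"
  by (simp add: plus_conn_def)

lemma plus_conn_trans: "plus_conn W p q \<Longrightarrow> plus_conn W q r \<Longrightarrow> plus_conn W p r"
  unfolding plus_conn_def by (rule rtranclp_trans)

lemma plus_conn_sym: "plus_conn W p q \<Longrightarrow> plus_conn W q p"
  unfolding plus_conn_def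
  by (metis (no_types, lifting) plus_adj_sym symp_def symp_rtranclp)

lemma plus_conn_adj: "p \<in> W \<Longrightarrow> q \<in> W \<Longrightarrow> plus_adj p q \<Longrightarrow> plus_conn W p q"
  unfolding plus_conn_def by auto

lemma plus_conn_mono: "W \<subseteq> W' \<Longrightarrow> plus_conn W p q \<Longrightarrow> plus_conn W' p q"
  unfolding plus_conn_def by (erule rtranclp_mono[THEN predicate2D, rotated]) auto

lemma plus_conn_in: "plus_conn W p q \<Longrightarrow> p \<in> W \<Longrightarrow> q \<in> W"
  unfolding plus_conn_def by (induction rule: rtranclp_induct) auto

lemma plus_conn_horizontal:
  assumes "\<And>k. a \<le> k \<Longrightarrow> k \<le> b \<Longrightarrow> (k, j) \<in> W" "a \<le> b"
  shows "plus_conn W (a, j) (b, j)"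
  using assms(2,1)
proof (induction b rule: int_ge_induct)
  case (step b)
  have "plus_conn W (a, j) (b, j)" using step by simp
  moreover have "plus_conn W (b, j) (b + 1, j)"
    using step by (intro plus_conn_adj) (auto simp: plus_adj_iff)
  ultimately show ?case by (rule plus_conn_trans)
qed simp

lemma plus_conn_vertical:
  assumes "\<And>k. a \<le> k \<Longrightarrow> k \<le> b \<Longrightarrow> (i, k) \<in> W" "a \<le> b"
  shows "plus_conn W (i, a) (i, b)"
  using assms(2,1)
proof (induction b rule: int_ge_induct)
  case (step b)
  have "plus_conn W (i, a) (i, b)" using step by simp
  moreover have "plus_conn W (i, b) (i, b + 1)"
    using step by (intro plus_conn_adj) (auto simp: plus_adj_iff)
  ultimately show ?case by (rule plus_conn_trans)
qed simp

lemma plus_conn_row: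
  assumes "\<And>k. (k, j) \<in> W"
  shows "plus_conn W (a, j) (b, j)"
  using plus_conn_horizontal[of a b j W] plus_conn_horizontal[of b a j W] assms plus_conn_sym
  by (cases "a \<le> b") auto

lemma plus_conn_column:
  assumes "\<And>k. (i, k) \<in> W"
  shows "plus_conn W (i, a) (i, b)"
  using plus_conn_vertical[of a b i W] plus_conn_vertical[of b a i W] assms plus_conn_sym
  by (cases "a \<le> b") auto

text \<open>All squares outside a box around \<open>C\<close> are joined to each other outside the
  box, so the component of \<open>- C\<close> containing one of them has finite complement.\<close>

lemma exterior_region_exists:
  assumes "finite C"
  obtains U where "U \<inter> C = {}" "finite (- U)" "\<And>p q. p \<in> U \<Longrightarrow> q \<in> U \<Longrightarrow> plus_conn U p q"
    "\<And>p q. p \<in> U \<Longrightarrow> plus_adj p q \<Longrightarrow> q \<notin> C \<Longrightarrow> q \<in> U"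
proof -
  obtain N where N: "\<And>i j. (i, j) \<in> C \<Longrightarrow> \<bar>i\<bar> \<le> N \<and> \<bar>j\<bar> \<le> N"
  proof -
    define S where "S = (\<lambda>p. max \<bar>fst p\<bar> \<bar>snd p\<bar>) ` C"
    have "bdd_above S" using assms by (simp add: S_def)
    then obtain N where "\<And>x. x \<in> S \<Longrightarrow> x \<le> N" by (auto simp: bdd_above_def)
    then show thesis by (intro that[of N]) (force simp: S_def)
  qed
  define U where "U = {p. plus_conn (- C) (0, N + 1) p}"
  have free: "(i, j) \<in> - C" if "N < \<bar>i\<bar> \<or> N < \<bar>j\<bar>" for i j using N that by fastforce
  have top: "(i, j) \<in> U" if "N < j" for i j
  proof -
    have "plus_conn (- C) (0, N + 1) (0, j)"
      by (rule plus_conn_vertical) (rule free, use that in linarith, use that in linarith)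
    moreover have "plus_conn (- C) (0, j) (i, j)"
      by (rule plus_conn_row) (rule free, use that in linarith)+
    ultimately show ?thesis unfolding U_def using plus_conn_trans by blast
  qed
  have col: "(i, j) \<in> U" if "N < \<bar>i\<bar>" for i j
  proof -
    have "plus_conn (- C) (i, N + 1) (i, j)"
      by (rule plus_conn_column) (rule free, use that in linarith)+
    moreover have "plus_conn (- C) (0, N + 1) (i, N + 1)" using top[of "N + 1" i] by (simp add: U_def)
    ultimately show ?thesis unfolding U_def using plus_conn_trans by blast
  qed
  have row: "(i, j) \<in> U" if "N < \<bar>j\<bar>" for i j
  proof -
    \<comment> \<open>Rows below the box are reached through a column beside it. The absolute value
      keeps that column outside even for negative \<open>N\<close>, which is possible when
      \<open>C\<close> is empty.\<close>
    have "plus_conn (- C) (\<bar>N\<bar> + 1, j) (i, j)"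
      by (rule plus_conn_row) (rule free, use that in linarith)+
    moreover have "plus_conn (- C) (0, N + 1) (\<bar>N\<bar> + 1, j)" using col[of "\<bar>N\<bar> + 1" j] by (simp add: U_def)
    ultimately show ?thesis unfolding U_def using plus_conn_trans by blast
  qed
  have start: "(0, N + 1) \<in> - C" by (rule free) linarith
  have UC: "U \<inter> C = {}" using plus_conn_in[OF _ start] unfolding U_def by auto
  have fin: "finite (- U)"
  proof (rule finite_subset)
    show "- U \<subseteq> {-N..N} \<times> {-N..N}"
    proof
      fix p assume p: "p \<in> - U"
      obtain i j where ij: "p = (i, j)" by (cases p)
      then have "\<not> N < \<bar>i\<bar>" "\<not> N < \<bar>j\<bar>" using p row[of j i] col[of i j] by auto
      then show "p \<in> {-N..N} \<times> {-N..N}" using ij by auto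
    qed
  qed simp
  \<comment> \<open>A path in \<open>- C\<close> from the start visits only squares reachable from
    the start, so it already runs in \<open>U\<close>.\<close>
  have from_start: "plus_conn U (0, N + 1) p" if "p \<in> U" for p
  proof -
    have "plus_conn (- C) (0, N + 1) p" using that by (simp add: U_def)
    then show ?thesis unfolding plus_conn_def
    proof (induction rule: rtranclp_induct)
      case (step y z)
      have "plus_conn (- C) (0, N + 1) y" using step(1) by (simp add: plus_conn_def)
      moreover from this have "plus_conn (- C) (0, N + 1) z"
        using step(2) plus_conn_adj plus_conn_trans by blast
      ultimately have "y \<in> U \<and> z \<in> U \<and> plus_adj y z" using step(2) by (simp add: U_def)
      then show ?case using step(3) by (rule rtranclp.rtrancl_into_rtrancl[rotated])
    qed simp
  qed
  show thesis
  proof (rule that[OF UC fin])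
    show "plus_conn U p q" if "p \<in> U" "q \<in> U" for p q
      by (rule plus_conn_trans[OF plus_conn_sym[OF from_start[OF that(1)]] from_start[OF that(2)]])
    show "q \<in> U" if "p \<in> U" "plus_adj p q" "q \<notin> C" for p q
    proof -
      have "p \<notin> C" using UC that by auto
      then have "plus_conn (- C) p q" using that by (intro plus_conn_adj) auto
      then show ?thesis using that(1) plus_conn_trans[of "- C" "(0, N + 1)" p q] by (simp add: U_def)
    qed
  qed
qed

section \<open>Interior and exterior of boundary curves\<close>

definition center :: "sqidx \<Rightarrow> pt" where
  "center p = (real_of_int (fst p), real_of_int (snd p))"

section \<open>Segments and squares in real coordinates\<close>

lemma seg_hedge: "seg (hedge i j) = {(x, y). \<bar>x - real_of_int i\<bar> \<le> 1/2 \<and> y = real_of_int j - 1/2}"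
proof -
  have "(x, y) \<in> closed_segment (lattice_pt i j) (lattice_pt (i + 1) j) \<longleftrightarrow>
      \<bar>x - real_of_int i\<bar> \<le> 1/2 \<and> y = real_of_int j - 1/2" for x y
  proof
    assume "(x, y) \<in> closed_segment (lattice_pt i j) (lattice_pt (i + 1) j)"
    then obtain u where u: "0 \<le> u" "u \<le> 1"
      "(x, y) = (1 - u) *\<^sub>R lattice_pt i j + u *\<^sub>R lattice_pt (i + 1) j"
      by (auto simp: closed_segment_def)
    then have "x = real_of_int i - 1/2 + u" "y = real_of_int j - 1/2"
      by (auto simp: lattice_pt_def field_simps)
    then show "\<bar>x - real_of_int i\<bar> \<le> 1/2 \<and> y = real_of_int j - 1/2" using u(1,2) by (intro conjI) linarith+
  next
    assume xy: "\<bar>x - real_of_int i\<bar> \<le> 1/2 \<and> y = real_of_int j - 1/2"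
    define u where "u = x - real_of_int i + 1/2"
    have "0 \<le> u" "u \<le> 1" using xy unfolding u_def by linarith+
    moreover have "(x, y) = (1 - u) *\<^sub>R lattice_pt i j + u *\<^sub>R lattice_pt (i + 1) j"
      using xy by (simp add: lattice_pt_def field_simps u_def)
    ultimately show "(x, y) \<in> closed_segment (lattice_pt i j) (lattice_pt (i + 1) j)"
      unfolding closed_segment_def by blast
  qed
  then show ?thesis by (auto simp: seg_def hedge_def segment_convex_hull)
qed

lemma seg_vedge: "seg (vedge i j) = {(x, y). x = real_of_int i - 1/2 \<and> \<bar>y - real_of_int j\<bar> \<le> 1/2}"
proof -
  have "(x, y) \<in> closed_segment (lattice_pt i j) (lattice_pt i (j + 1)) \<longleftrightarrow>
      x = real_of_int i - 1/2 \<and> \<bar>y - real_of_int j\<bar> \<le> 1/2" for x y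
  proof
    assume "(x, y) \<in> closed_segment (lattice_pt i j) (lattice_pt i (j + 1))"
    then obtain u where u: "0 \<le> u" "u \<le> 1"
      "(x, y) = (1 - u) *\<^sub>R lattice_pt i j + u *\<^sub>R lattice_pt i (j + 1)"
      by (auto simp: closed_segment_def)
    then have "x = real_of_int i - 1/2" "y = real_of_int j - 1/2 + u"
      by (auto simp: lattice_pt_def field_simps)
    then show "x = real_of_int i - 1/2 \<and> \<bar>y - real_of_int j\<bar> \<le> 1/2" using u(1,2) by (intro conjI) linarith+
  next
    assume xy: "x = real_of_int i - 1/2 \<and> \<bar>y - real_of_int j\<bar> \<le> 1/2"
    define u where "u = y - real_of_int j + 1/2"
    have "0 \<le> u" "u \<le> 1" using xy unfolding u_def by linarith+
    moreover have "(x, y) = (1 - u) *\<^sub>R lattice_pt i j + u *\<^sub>R lattice_pt i (j + 1)"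
      using xy by (simp add: lattice_pt_def field_simps u_def)
    ultimately show "(x, y) \<in> closed_segment (lattice_pt i j) (lattice_pt i (j + 1))"
      unfolding closed_segment_def by blast
  qed
  then show ?thesis by (auto simp: seg_def vedge_def segment_convex_hull)
qed

lemma open_seg_hedge: "open_seg (hedge i j) = {(x, y). \<bar>x - real_of_int i\<bar> < 1/2 \<and> y = real_of_int j - 1/2}"
proof -
  have ends: "(x, y) \<in> hedge i j \<longleftrightarrow>
      (x = real_of_int i - 1/2 \<or> x = real_of_int i + 1/2) \<and> y = real_of_int j - 1/2" for x y
    by (auto simp: hedge_def lattice_pt_def)
  have "open_seg (hedge i j) = seg (hedge i j) - hedge i j" by (simp add: open_seg_def seg_def)
  then have "(x, y) \<in> open_seg (hedge i j) \<longleftrightarrow> \<bar>x - real_of_int i\<bar> < 1/2 \<and> y = real_of_int j - 1/2" for x y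
    unfolding seg_hedge by (smt (verit) Diff_iff ends mem_Collect_eq case_prod_conv)
  then show ?thesis by blast
qed

lemma open_seg_vedge: "open_seg (vedge i j) = {(x, y). x = real_of_int i - 1/2 \<and> \<bar>y - real_of_int j\<bar> < 1/2}"
proof -
  have ends: "(x, y) \<in> vedge i j \<longleftrightarrow>
      x = real_of_int i - 1/2 \<and> (y = real_of_int j - 1/2 \<or> y = real_of_int j + 1/2)" for x y
    by (auto simp: vedge_def lattice_pt_def)
  have "open_seg (vedge i j) = seg (vedge i j) - vedge i j" by (simp add: open_seg_def seg_def)
  then have "(x, y) \<in> open_seg (vedge i j) \<longleftrightarrow> x = real_of_int i - 1/2 \<and> \<bar>y - real_of_int j\<bar> < 1/2" for x y
    unfolding seg_vedge by (smt (verit) Diff_iff ends mem_Collect_eq case_prod_conv)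
  then show ?thesis by blast
qed

lemma open_seg_nonempty:
  assumes "e \<in> lattice_edges"
  shows "open_seg e \<noteq> {}"
  using assms
proof (cases rule: lattice_edge_cases)
  case (1 i j)
  then have "(real_of_int i, real_of_int j - 1/2) \<in> open_seg e" by (simp add: open_seg_hedge)
  then show ?thesis by auto
next
  case (2 i j)
  then have "(real_of_int i - 1/2, real_of_int j) \<in> open_seg e" by (simp add: open_seg_vedge)
  then show ?thesis by auto
qed

lemma in_square_iff: "(x, y) \<in> square (i, j) \<longleftrightarrow> \<bar>x - real_of_int i\<bar> \<le> 1/2 \<and> \<bar>y - real_of_int j\<bar> \<le> 1/2"
  by (simp add: square_def)

lemma square_Times:
  "square p = {real_of_int (fst p) - 1/2..real_of_int (fst p) + 1/2} \<times>
              {real_of_int (snd p) - 1/2..real_of_int (snd p) + 1/2}"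
proof -
  have "\<bar>x - a\<bar> \<le> 1/2 \<longleftrightarrow> x \<in> {a - 1/2..a + 1/2}" for x a :: real unfolding atLeastAtMost_iff by linarith
  then show ?thesis unfolding square_def by blast
qed

lemma interior_square:
  "interior (square (i, j)) = {(x, y). \<bar>x - real_of_int i\<bar> < 1/2 \<and> \<bar>y - real_of_int j\<bar> < 1/2}"
proof -
  have "\<bar>x - a\<bar> < 1/2 \<longleftrightarrow> x \<in> {a - 1/2<..<a + 1/2}" for x a :: real
    unfolding greaterThanLessThan_iff by linarith
  moreover have "interior (square (i, j)) =
      {real_of_int i - 1/2<..<real_of_int i + 1/2} \<times> {real_of_int j - 1/2<..<real_of_int j + 1/2}"
    unfolding square_Times interior_Times by simp
  ultimately show ?thesis by blast
qed

lemma convex_square: "convex (square p)"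
  unfolding square_Times by (intro convex_Times) auto

lemma closed_square: "closed (square p)"
  unfolding square_Times by (intro closed_Times) auto

lemma bounded_square: "bounded (square p)"
  unfolding square_Times by (intro bounded_Times) auto

lemma center_in_interior: "center p \<in> interior (square p)"
  by (cases p) (simp add: center_def interior_square)

lemma closure_interior_square: "closure (interior (square p)) = square p"
  using convex_closure_interior[OF convex_square, of p] center_in_interior[of p] closed_square[of p]
  by (auto simp: closure_closed)

lemma seg_subset_square: "e \<in> sides p \<Longrightarrow> seg e \<subseteq> square p"
  by (cases p) (auto simp: sides_conv seg_hedge seg_vedge in_square_iff)

lemma open_seg_subset_square: "e \<in> sides p \<Longrightarrow> open_seg e \<subseteq> square p"
  using seg_subset_square[of e p] by (auto simp: open_seg_def seg_def)

lemma of_int_abs_diff_less_1: "\<bar>real_of_int a - real_of_int b\<bar> < 1 \<Longrightarrow> a = b"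
  by linarith

text \<open>Keeps lattice lines out of open squares, and off the relative interiors of edges
  perpendicular to them.\<close>

lemma half_integer_far: "\<not> \<bar>real_of_int a - 1/2 - real_of_int b\<bar> < 1/2"
proof
  assume h: "\<bar>real_of_int a - 1/2 - real_of_int b\<bar> < 1/2"
  then have "real_of_int b < real_of_int a" "real_of_int a < real_of_int (b + 1)" by linarith+
  then show False by (simp only: of_int_less_iff)
qed

lemma interior_square_disjoint_curve:
  assumes "K \<subseteq> lattice_edges"
  shows "interior (square p) \<inter> curve K = {}"
proof -
  have "z \<notin> seg e" if "z \<in> interior (square p)" "e \<in> lattice_edges" for z e
  proof -
    obtain i j where p: "p = (i, j)" by (cases p)
    obtain x y where z: "z = (x, y)" by (cases z)
    have b: "\<bar>x - real_of_int i\<bar> < 1/2" "\<bar>y - real_of_int j\<bar> < 1/2"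
      using that(1) p z by (auto simp: interior_square)
    show ?thesis using that(2)
      by (cases rule: lattice_edge_cases)
        (use b z half_integer_far in \<open>auto simp: seg_hedge seg_vedge\<close>)
  qed
  then show ?thesis using assms unfolding curve_def by blast
qed

text \<open>A relatively interior point of an edge lies on no other edge: parallel edges on the same
  line would have indices less than 1 apart, and perpendicular ones are excluded by
  \<open>half_integer_far\<close>.\<close>

lemma open_seg_disjoint_curve:
  assumes "K \<subseteq> lattice_edges" "e \<in> lattice_edges" "e \<notin> K"
  shows "open_seg e \<inter> curve K = {}"
proof -
  have "f = e" if "z \<in> open_seg e" "z \<in> seg f" "f \<in> lattice_edges" for z f
  proof -
    obtain x y where z: "z = (x, y)" by (cases z)
    show ?thesis using assms(2)
    proof (cases rule: lattice_edge_cases)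
      case e: (1 i j)
      from that(3) show ?thesis
      proof (cases rule: lattice_edge_cases)
        case (1 k l)
        then have "\<bar>x - real_of_int i\<bar> < 1/2" "\<bar>x - real_of_int k\<bar> \<le> 1/2" "j = l"
          using that(1,2) e z by (auto simp: open_seg_hedge seg_hedge)
        moreover have "i = k" by (rule of_int_abs_diff_less_1) (use calculation in linarith)
        ultimately show ?thesis using 1 e by simp
      next
        case (2 k l)
        then show ?thesis using that(1,2) e z half_integer_far by (auto simp: open_seg_hedge seg_vedge)
      qed
    next
      case e: (2 i j)
      from that(3) show ?thesis
      proof (cases rule: lattice_edge_cases)
        case (1 k l)
        then show ?thesis using that(1,2) e z half_integer_far by (auto simp: open_seg_vedge seg_hedge)
      next
        case (2 k l)
        then have "\<bar>y - real_of_int j\<bar> < 1/2" "\<bar>y - real_of_int l\<bar> \<le> 1/2" "i = k"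
          using that(1,2) e z by (auto simp: open_seg_vedge seg_vedge)
        moreover have "j = l" by (rule of_int_abs_diff_less_1) (use calculation in linarith)
        ultimately show ?thesis using 2 e by simp
      qed
    qed
  qed
  then show ?thesis using assms unfolding curve_def by blast
qed

section \<open>Components of the complement of a lattice curve\<close>

lemma squares_cover: "\<exists>p. z \<in> square p"
proof -
  obtain x y where z: "z = (x, y)" by (cases z)
  have "\<bar>x - real_of_int (round x)\<bar> \<le> 1/2" "\<bar>y - real_of_int (round y)\<bar> \<le> 1/2"
    using of_int_round_abs_le[of x] of_int_round_abs_le[of y] by linarith+
  then have "z \<in> square (round x, round y)" by (simp add: z in_square_iff)
  then show ?thesis by blast
qed

text \<open>The open square avoids the curve, and adding one point of its closure keeps it
  connected; so \<open>x\<close> may lie on the frontier of the square.\<close>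

lemma connected_component_center:
  assumes "K \<subseteq> lattice_edges" "x \<in> square p" "x \<notin> curve K"
  shows "connected_component (- curve K) x (center p)"
proof -
  have "connected (insert x (interior (square p)))"
    by (rule connected_intermediate_closure[of "interior (square p)"])
      (use assms(2) closure_interior_square[of p] closure_subset interior_subset in
        \<open>auto intro!: convex_connected convex_interior convex_square\<close>)
  moreover have "insert x (interior (square p)) \<subseteq> - curve K"
    using interior_square_disjoint_curve[OF assms(1), of p] assms(3) by auto
  ultimately show ?thesis
    unfolding connected_component_def using center_in_interior by blast
qed

text \<open>Neighbouring centres are joined through a point of their common open side, which misses
  the curve when that side is not in \<open>K\<close>.\<close>

lemma connected_component_plus_conn:
  assumes "K \<subseteq> lattice_edges" "plus_conn W p q"
    and "\<And>a b e. a \<in> W \<Longrightarrow> b \<in> W \<Longrightarrow> a \<noteq> b \<Longrightarrow> e \<in> sides a \<Longrightarrow> e \<in> sides b \<Longrightarrow> e \<notin> K"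
  shows "connected_component (- curve K) (center p) (center q)"
  using assms(2) unfolding plus_conn_def
proof (induction rule: rtranclp_induct)
  case base
  have "center p \<in> - curve K"
    using interior_square_disjoint_curve[OF assms(1), of p] center_in_interior[of p] by auto
  then show ?case by (simp add: connected_component_refl)
next
  case (step a b)
  then obtain e where e: "e \<in> sides a" "e \<in> sides b" "a \<noteq> b" by (auto simp: plus_adj_def)
  then have "e \<notin> K" using assms(3) step by blast
  moreover have el: "e \<in> lattice_edges" using e sides_subset_lattice_edges by blast
  ultimately have disj: "open_seg e \<inter> curve K = {}" using open_seg_disjoint_curve assms(1) by blast
  obtain x where x: "x \<in> open_seg e" using open_seg_nonempty[OF el] by auto
  then have "x \<in> square a" "x \<in> square b" "x \<notin> curve K"
    using open_seg_subset_square e disj by blast+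
  then have "connected_component (- curve K) (center a) (center b)"
    by (intro connected_component_trans[OF connected_component_sym[OF connected_component_center[OF assms(1)]]
          connected_component_center[OF assms(1)]])
  with step(3) show ?case by (rule connected_component_trans)
qed

lemma finite_if_bounded_centers:
  assumes "bounded (center ` W)"
  shows "finite W"
proof -
  obtain b where b: "\<And>q. q \<in> W \<Longrightarrow> norm (center q) \<le> b"
    using assms by (auto simp: bounded_iff)
  have "q \<in> {-\<lfloor>b\<rfloor>..\<lfloor>b\<rfloor>} \<times> {-\<lfloor>b\<rfloor>..\<lfloor>b\<rfloor>}" if "q \<in> W" for q
  proof -
    have "\<bar>real_of_int (fst q)\<bar> \<le> b" "\<bar>real_of_int (snd q)\<bar> \<le> b"
      using b[OF that] norm_fst_le[of "real_of_int (fst q)" "real_of_int (snd q)"]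
        norm_snd_le[of "real_of_int (snd q)" "real_of_int (fst q)"]
      by (auto simp: center_def)
    then have "\<bar>fst q\<bar> \<le> \<lfloor>b\<rfloor>" "\<bar>snd q\<bar> \<le> \<lfloor>b\<rfloor>" by (simp_all add: le_floor_iff)
    then show ?thesis by (cases q) auto
  qed
  then have "W \<subseteq> {-\<lfloor>b\<rfloor>..\<lfloor>b\<rfloor>} \<times> {-\<lfloor>b\<rfloor>..\<lfloor>b\<rfloor>}" by blast
  then show ?thesis by (rule finite_subset) simp
qed

text \<open>The component of \<open>x\<close> contains the centres of all squares of
  \<open>W\<close>. Infinitely many lattice points are unbounded, so the component is too.\<close>

lemma in_outside_curve:
  assumes "K \<subseteq> lattice_edges" "infinite W"
    and conn: "\<And>p q. p \<in> W \<Longrightarrow> q \<in> W \<Longrightarrow> plus_conn W p q"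
    and avoid: "\<And>a b e. a \<in> W \<Longrightarrow> b \<in> W \<Longrightarrow> a \<noteq> b \<Longrightarrow> e \<in> sides a \<Longrightarrow> e \<in> sides b \<Longrightarrow> e \<notin> K"
    and "p \<in> W" "x \<in> square p" "x \<notin> curve K"
  shows "x \<in> outside (curve K)"
proof (rule ccontr)
  assume "x \<notin> outside (curve K)"
  then have bd: "bounded (connected_component_set (- curve K) x)"
    using assms(7) by (simp add: outside_def)
  have "center q \<in> connected_component_set (- curve K) x" if "q \<in> W" for q
    using connected_component_trans[OF connected_component_center[OF assms(1,6,7)]
      connected_component_plus_conn[OF assms(1) conn[OF assms(5) that] avoid]]
    by simp
  then have "center ` W \<subseteq> connected_component_set (- curve K) x" by blast
  then have "bounded (center ` W)" by (rule bounded_subset[OF bd])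
  then show False using finite_if_bounded_centers assms(2) by blast
qed

lemma squares_cross_boundary:
  assumes "p \<in> A" "q \<notin> A" "z \<in> square p" "z \<in> square q"
  shows "z \<in> curve (sq_boundary A)"
proof -
  obtain x y where z: "z = (x, y)" by (cases z)
  obtain i j where p: "p = (i, j)" by (cases p)
  obtain k l where q: "q = (k, l)" by (cases q)
  have b: "\<bar>x - real_of_int i\<bar> \<le> 1/2" "\<bar>y - real_of_int j\<bar> \<le> 1/2"
    "\<bar>x - real_of_int k\<bar> \<le> 1/2" "\<bar>y - real_of_int l\<bar> \<le> 1/2"
    using assms(3,4) by (auto simp: p q z in_square_iff)
  \<comment> \<open>The square \<open>(k, j)\<close> also contains \<open>z\<close> and equals or shares a side with each of \<open>p\<close> and \<open>q\<close>.\<close>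
  have "\<exists>e\<in>sq_boundary A. z \<in> seg e"
  proof (cases "(k, j) \<in> A")
    case True
    then have "j \<noteq> l" using assms(2) q by auto
    moreover have "\<bar>j - l\<bar> \<le> 1" using b by linarith
    ultimately have "j = l + 1 \<or> l = j + 1" by linarith
    then show ?thesis
    proof
      assume jl: "j = l + 1"
      then have "hedge k j \<in> sq_boundary A" using True assms(2) q by (simp add: hedge_in_boundary)
      moreover have "z \<in> seg (hedge k j)" using b jl by (simp add: z seg_hedge)
      ultimately show ?thesis by blast
    next
      assume jl: "l = j + 1"
      then have "hedge k l \<in> sq_boundary A" using True assms(2) q by (simp add: hedge_in_boundary)
      moreover have "z \<in> seg (hedge k l)" using b jl by (simp add: z seg_hedge)
      ultimately show ?thesis by blast
    qed
  next
    case False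
    then have "i \<noteq> k" using assms(1) p by auto
    moreover have "\<bar>i - k\<bar> \<le> 1" using b by linarith
    ultimately have "i = k + 1 \<or> k = i + 1" by linarith
    then show ?thesis
    proof
      assume ik: "i = k + 1"
      then have "vedge i j \<in> sq_boundary A" using False assms(1) p by (simp add: vedge_in_boundary)
      moreover have "z \<in> seg (vedge i j)" using b ik by (simp add: z seg_vedge)
      ultimately show ?thesis by blast
    next
      assume ik: "k = i + 1"
      then have "vedge k j \<in> sq_boundary A" using False assms(1) p by (simp add: vedge_in_boundary)
      moreover have "z \<in> seg (vedge k j)" using b ik by (simp add: z seg_vedge)
      ultimately show ?thesis by blast
    qed
  qed
  then show ?thesis by (auto simp: curve_def)
qed

text \<open>The set \<open>A\<close> may be infinite, so local finiteness is used: squares meeting a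
  unit ball have centres within distance 2 of its centre.\<close>

lemma closed_Union_squares: "closed (\<Union>(square ` A))"
proof -
  have "\<exists>V. open V \<and> z \<in> V \<and> finite {S \<in> square ` A. S \<inter> V \<noteq> {}}" for z
  proof (intro exI[of _ "ball z 1"] conjI)
    have "finite {q. square q \<inter> ball z 1 \<noteq> {}}"
    proof (rule finite_if_bounded_centers, rule bounded_subset)
      show "bounded (cball z 2)" by simp
      show "center ` {q. square q \<inter> ball z 1 \<noteq> {}} \<subseteq> cball z 2"
      proof (rule image_subsetI)
        fix q assume "q \<in> {q. square q \<inter> ball z 1 \<noteq> {}}"
        then obtain w where "w \<in> square q" and w: "w \<in> ball z 1" by auto
        obtain i j where q: "q = (i, j)" by (cases q)
        have wq: "w \<in> square (i, j)" using \<open>w \<in> square q\<close> q by simp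
        obtain x y where xy: "w = (x, y)" by (cases w)
        have "dist w (center (i, j)) \<le> \<bar>x - real_of_int i\<bar> + \<bar>y - real_of_int j\<bar>"
          unfolding xy center_def dist_norm using norm_Pair_le[of "x - real_of_int i" "y - real_of_int j"] by simp
        also have "\<dots> \<le> 1" using wq xy by (simp add: in_square_iff)
        finally show "center q \<in> cball z 2"
          using q w dist_triangle[of z "center (i, j)" w] by simp
      qed
    qed
    then have "finite (square ` {q. square q \<inter> ball z 1 \<noteq> {}})" by (rule finite_imageI)
    then show "finite {S \<in> square ` A. S \<inter> ball z 1 \<noteq> {}}" by (rule finite_subset[rotated]) auto
  qed auto
  then have "locally_finite_in euclidean (square ` A)" by (simp add: locally_finite_in_def)
  then have "closedin euclidean (\<Union>(square ` A))"
    by (intro closedin_locally_finite_Union) (auto simp: closed_square)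
  then show ?thesis by simp
qed

text \<open>The squares of \<open>A\<close> and those of its complement form two closed sets
  covering the plane, and they overlap only on the curve. The component of \<open>z\<close> avoids
  the curve, so it stays within the bounded union of the squares of \<open>A\<close>.\<close>

lemma in_inside_curve:
  assumes "finite A" "p \<in> A" "z \<in> square p" "z \<notin> curve (sq_boundary A)"
  shows "z \<in> inside (curve (sq_boundary A))"
proof -
  define Z where "Z = connected_component_set (- curve (sq_boundary A)) z"
  have Zsub: "Z \<subseteq> - curve (sq_boundary A)" unfolding Z_def by (rule connected_component_subset)
  have "\<Union>(square ` A) \<inter> \<Union>(square ` (- A)) \<subseteq> curve (sq_boundary A)"
    using squares_cross_boundary by blast
  then have "\<Union>(square ` A) \<inter> \<Union>(square ` (- A)) \<inter> Z = {}" using Zsub by blast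
  moreover have "connected Z" unfolding Z_def by simp
  moreover have "Z \<subseteq> \<Union>(square ` A) \<union> \<Union>(square ` (- A))" using squares_cover by blast
  moreover have "z \<in> Z" unfolding Z_def using assms(4) by (simp add: connected_component_refl)
  ultimately have "\<Union>(square ` (- A)) \<inter> Z = {}"
    using connected_closedD[of Z "\<Union>(square ` A)" "\<Union>(square ` (- A))"] closed_Union_squares assms(2,3) by blast
  then have "Z \<subseteq> \<Union>(square ` A)" using squares_cover by blast
  moreover have "bounded (\<Union>(square ` A))" using assms(1) bounded_square by auto
  ultimately have "bounded Z" by (rule bounded_subset[rotated])
  then show ?thesis using assms(4) unfolding inside_def Z_def by simp
qed

text \<open>The complement of \<open>A\<close> is infinite and edge-connected, and no side shared by
  two of its squares is a boundary edge; \<open>in_outside_curve\<close> applies. Points of the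
  inside can then only lie in squares of \<open>A\<close>.\<close>

lemma
  assumes "finite A" "\<And>p q. p \<notin> A \<Longrightarrow> q \<notin> A \<Longrightarrow> plus_conn (- A) p q"
  shows inside_curve_subset: "inside (curve (sq_boundary A)) \<subseteq> \<Union>(square ` A)"
    and compl_square_in_outside: "\<And>p z. p \<notin> A \<Longrightarrow> z \<in> square p \<Longrightarrow> z \<notin> curve (sq_boundary A) \<Longrightarrow> z \<in> outside (curve (sq_boundary A))"
proof -
  have inf: "infinite (- A)" using assms(1) by (metis Compl_eq_Diff_UNIV Diff_infinite_finite
        finite_prod infinite_UNIV_int)
  have av: "e \<notin> sq_boundary A" if "a \<in> - A" "b \<in> - A" "a \<noteq> b" "e \<in> sides a" "e \<in> sides b" for a b e
    using that sides_unique[OF that(4,5,3)] unfolding sq_boundary_def by blast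
  show out: "z \<in> outside (curve (sq_boundary A))"
    if "p \<notin> A" "z \<in> square p" "z \<notin> curve (sq_boundary A)" for p z
  proof (rule in_outside_curve[OF sq_boundary_subset inf])
    show "plus_conn (- A) a b" if "a \<in> - A" "b \<in> - A" for a b using assms(2) that by simp
    show "p \<in> - A" using that by simp
  qed (use av that in blast)+
  show "inside (curve (sq_boundary A)) \<subseteq> \<Union>(square ` A)"
  proof
    fix z assume z: "z \<in> inside (curve (sq_boundary A))"
    obtain p where p: "z \<in> square p" using squares_cover by blast
    have "z \<notin> curve (sq_boundary A)" "z \<notin> outside (curve (sq_boundary A))"
      using z inside_no_overlap inside_Int_outside by blast+
    then show "z \<in> \<Union>(square ` A)" using out[of p z] p by blast
  qed
qed

section \<open>The components enclosed by the exterior region\<close>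

lemma in_sq_boundary_iff:
  assumes "e \<in> sides x" "e \<in> sides y" "x \<noteq> y"
  shows "e \<in> sq_boundary A \<longleftrightarrow> (x \<in> A) \<noteq> (y \<in> A)"
  using assms sides_unique[OF assms] unfolding sq_boundary_def by blast

text \<open>Membership in \<open>A\<close> changes only across edges of
  \<open>sq_boundary A\<close>, and the path crosses none.\<close>

lemma plus_conn_same_side:
  assumes "plus_conn W a b"
    and "\<And>x y e. x \<in> W \<Longrightarrow> y \<in> W \<Longrightarrow> x \<noteq> y \<Longrightarrow> e \<in> sides x \<Longrightarrow> e \<in> sides y \<Longrightarrow> e \<notin> sq_boundary A"
  shows "a \<in> A \<longleftrightarrow> b \<in> A"
  using assms(1) unfolding plus_conn_def
proof (induction rule: rtranclp_induct)
  case (step y z)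
  then obtain e where e: "e \<in> sides y" "e \<in> sides z" "y \<noteq> z" by (auto simp: plus_adj_def)
  then have "e \<notin> sq_boundary A" using assms(2) step by blast
  then show ?case using step(3) in_sq_boundary_iff[OF e] by blast
qed simp

lemma is_cycle_mono: "is_cycle E K \<Longrightarrow> K \<subseteq> E' \<Longrightarrow> is_cycle E' K"
  unfolding is_cycle_conv by auto

lemma is_cycle_subset: "is_cycle E K \<Longrightarrow> K \<subseteq> E"
  unfolding is_cycle_conv by auto

text \<open>Turns geometric incidence with a segment into incidence in the graph.\<close>

lemma lattice_pt_in_seg:
  assumes "e \<in> lattice_edges" "lattice_pt m n \<in> seg e"
  shows "lattice_pt m n \<in> e"
  using assms(1)
proof (cases rule: lattice_edge_cases)
  case (1 i j)
  then have "\<bar>real_of_int m - 1/2 - real_of_int i\<bar> \<le> 1/2" "n = j"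
    using assms(2) by (auto simp: seg_hedge lattice_pt_def)
  then have "real_of_int i \<le> real_of_int m" "real_of_int m \<le> real_of_int (i + 1)" by linarith+
  then have "i \<le> m" "m \<le> i + 1" by (simp_all only: of_int_le_iff)
  then show ?thesis using 1 \<open>n = j\<close> by auto
next
  case (2 i j)
  then have "\<bar>real_of_int n - 1/2 - real_of_int j\<bar> \<le> 1/2" "m = i"
    using assms(2) by (auto simp: seg_vedge lattice_pt_def)
  then have "real_of_int j \<le> real_of_int n" "real_of_int n \<le> real_of_int (j + 1)" by linarith+
  then have "j \<le> n" "n \<le> j + 1" by (simp_all only: of_int_le_iff)
  then show ?thesis using 2 \<open>m = i\<close> by auto
qed

lemma star_adj_common_corner:
  assumes "star_adj p q"
  obtains m n where "lattice_pt m n \<in> square p" "lattice_pt m n \<in> square q"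
proof -
  obtain i j where p: "p = (i, j)" by (cases p)
  obtain k l where q: "q = (k, l)" by (cases q)
  have corner: "lattice_pt m n \<in> square (i, j)" if "m = i \<or> m = i + 1" "n = j \<or> n = j + 1" for m n i j
    using that by (auto simp: lattice_pt_def in_square_iff)
  have "\<bar>i - k\<bar> \<le> 1" "\<bar>j - l\<bar> \<le> 1" using assms by (auto simp: p q star_adj_def)
  \<comment> \<open>Indices name lower left corners, so for squares at most one step apart the
    coordinatewise maximum is a corner of both.\<close>
  then have "lattice_pt (max i k) (max j l) \<in> square (i, j)" "lattice_pt (max i k) (max j l) \<in> square (k, l)"
    by (intro corner; linarith)+
  then show thesis using that p q by blast
qed

lemma common_corner_in_boundary:
  assumes "lattice_pt m n \<in> square p" "lattice_pt m n \<in> square q" "p \<in> A" "q \<notin> A"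
  shows "lattice_pt m n \<in> \<Union>(sq_boundary A)"
proof -
  obtain e where "e \<in> sq_boundary A" "lattice_pt m n \<in> seg e"
    using squares_cross_boundary[OF assms(3,4,1,2)] by (auto simp: curve_def)
  then show ?thesis using lattice_pt_in_seg sq_boundary_subset by blast
qed

text \<open>In other words, \<open>U\<close> is an edge-connected component of \<open>- C\<close>
  with finite complement.\<close>

locale exterior_region =
  fixes C U :: "sqidx set"
  assumes disjoint: "U \<inter> C = {}"
    and finite_compl: "finite (- U)"
    and connected: "\<And>p q. p \<in> U \<Longrightarrow> q \<in> U \<Longrightarrow> plus_conn U p q"
    and closed: "\<And>p q. p \<in> U \<Longrightarrow> plus_adj p q \<Longrightarrow> q \<notin> C \<Longrightarrow> q \<in> U"
begin

text \<open>The \<open>D\<^sub>i\<close> of the overview, named by any of its squares. For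
  \<open>p \<in> U\<close> it degenerates to \<open>{p}\<close>, hence the premise
  \<open>p \<notin> U\<close> in most lemmas below.\<close>

definition block :: "sqidx \<Rightarrow> sqidx set" where
  "block p = {q. plus_conn (- U) p q}"

definition rim :: "sqidx \<Rightarrow> pt set set" where
  "rim p = sq_boundary (block p)"

abbreviation edges :: "pt set set" where
  "edges \<equiv> (\<Union>p\<in>C. sides p)"

lemma infinite_U: "infinite U"
proof
  assume "finite U"
  then have "finite (U \<union> - U)" using finite_compl by blast
  then have "finite (UNIV :: sqidx set)" by simp
  then show False by (simp add: finite_prod infinite_UNIV_int)
qed

lemma self_in_block [simp]: "p \<in> block p"
  by (simp add: block_def)

lemma block_subset: "p \<notin> U \<Longrightarrow> block p \<subseteq> - U"
  using plus_conn_in[of "- U" p] by (auto simp: block_def)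

lemma finite_block: "p \<notin> U \<Longrightarrow> finite (block p)"
  using block_subset finite_compl finite_subset by blast

lemma block_eq: "q \<in> block p \<Longrightarrow> block q = block p"
  unfolding block_def using plus_conn_trans[of "- U"] plus_conn_sym[of "- U"] by blast

lemma block_adj:
  assumes "p \<notin> U" "a \<in> block p" "plus_adj a b" "b \<notin> U"
  shows "b \<in> block p"
proof -
  have "plus_conn (- U) a b" using assms block_subset[OF assms(1)] by (intro plus_conn_adj) auto
  then show ?thesis using assms(2) plus_conn_trans[of "- U" p a b] by (simp add: block_def)
qed

text \<open>The square across the edge is adjacent to the block without belonging to it, so it lies
  in \<open>U\<close>. By \<open>closed\<close>, the inner square must then be in \<open>C\<close>,
  or it would belong to \<open>U\<close> as well.\<close>

lemma rimE:
  assumes "p \<notin> U" "e \<in> rim p"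
  obtains a b where "a \<in> block p" "a \<in> C" "b \<in> U" "plus_adj a b" "e \<in> sides a" "e \<in> sides b"
proof -
  obtain a b where ab: "a \<in> block p" "b \<notin> block p" "e \<in> sides a" "e \<in> sides b"
    using assms(2) by (auto simp: rim_def sq_boundary_def)
  then have adj: "plus_adj a b" by (auto simp: plus_adj_def)
  have "b \<in> U" using block_adj[OF assms(1) ab(1) adj] ab(2) by blast
  moreover have "a \<notin> U" using ab(1) block_subset[OF assms(1)] by blast
  ultimately have "a \<in> C" using closed[of b a] plus_adj_sym[OF adj] by blast
  then show thesis using that ab adj \<open>b \<in> U\<close> by blast
qed

lemma rim_subset_edges: "p \<notin> U \<Longrightarrow> rim p \<subseteq> edges"
  using rimE by blast

lemma rim_subset_boundary:
  assumes "p \<notin> U"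
  shows "rim p \<subseteq> sq_boundary (- U)"
proof
  fix e assume "e \<in> rim p"
  then obtain a b where "a \<in> block p" "b \<in> U" "e \<in> sides a" "e \<in> sides b"
    using rimE[OF assms] by metis
  then show "e \<in> sq_boundary (- U)" using block_subset[OF assms] unfolding sq_boundary_def by blast
qed

lemma boundary_Union_rims: "sq_boundary (- U) = (\<Union>p\<in>- U. rim p)"
proof (intro equalityI subsetI)
  fix e assume "e \<in> sq_boundary (- U)"
  then obtain a b where ab: "a \<notin> U" "b \<in> U" "e \<in> sides a" "e \<in> sides b" by (auto simp: sq_boundary_def)
  then have "b \<notin> block a" using block_subset by blast
  then have "e \<in> rim a" using ab self_in_block[of a] unfolding rim_def sq_boundary_def by blast
  then show "e \<in> (\<Union>p\<in>- U. rim p)" using ab by blast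
qed (use rim_subset_boundary in blast)

lemma rim_nonempty: "p \<notin> U \<Longrightarrow> rim p \<noteq> {}"
  unfolding rim_def using sq_boundary_nonempty finite_block self_in_block by blast

lemma finite_boundary: "finite (sq_boundary (- U))"
  using finite_sq_boundary finite_compl by blast

text \<open>Of the two squares at a rim edge exactly one lies outside \<open>U\<close>, and it
  determines the block.\<close>

lemma rim_meets:
  assumes "p \<notin> U" "q \<notin> U" "e \<in> rim p" "e \<in> rim q"
  shows "block p = block q"
proof -
  obtain a b where ab: "a \<in> block p" "b \<in> U" "e \<in> sides a" "e \<in> sides b" using rimE[OF assms(1,3)] by metis
  obtain c d where cd: "c \<in> block q" "d \<in> U" "e \<in> sides c" "e \<in> sides d" using rimE[OF assms(2,4)] by metis
  have "a \<notin> U" "c \<notin> U" using ab cd block_subset assms by blast+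
  then have "c = a" using sides_unique[OF ab(3,4) _ cd(3)] ab(2) by blast
  then show ?thesis using ab(1) cd(1) block_eq by metis
qed

lemma rim_disjoint: "p \<notin> U \<Longrightarrow> q \<notin> U \<Longrightarrow> rim p \<noteq> rim q \<Longrightarrow> rim p \<inter> rim q = {}"
  using rim_meets unfolding rim_def by fastforce

text \<open>A square of another block walks within that block to its rim and steps into
  \<open>U\<close>; there all such walks are joined. This supplies the connectedness needed for
  exteriors of rims.\<close>

lemma compl_block_connected:
  assumes "p \<notin> U" "a \<notin> block p" "b \<notin> block p"
  shows "plus_conn (- block p) a b"
proof -
  have U: "U \<subseteq> - block p" using block_subset[OF assms(1)] by blast
  have reach: "\<exists>u\<in>U. plus_conn (- block p) c u" if c: "c \<notin> block p" for c
  proof (cases "c \<in> U")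
    case False
    obtain e where "e \<in> rim c" using rim_nonempty[OF False] by auto
    then obtain x u where xu: "x \<in> block c" "u \<in> U" "plus_adj x u" using rimE[OF False] by metis
    have sub: "block c \<subseteq> - block p"
    proof
      fix y assume "y \<in> block c"
      then have "y \<in> block p \<Longrightarrow> block c = block p" using block_eq by metis
      then show "y \<in> - block p" using c self_in_block[of c] by blast
    qed
    have "plus_conn (block c) c x"
    proof -
      have "plus_conn (- U) c x" using xu(1) by (simp add: block_def)
      then show ?thesis unfolding plus_conn_def
      proof (induction rule: rtranclp_induct)
        case (step y z)
        then have "y \<in> block c" by (simp add: block_def plus_conn_def)
        moreover from this have "z \<in> block c" using step(2) block_adj[OF False, of y z] by blast
        ultimately show ?case using step(2,3) by (simp add: rtranclp.rtrancl_into_rtrancl)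
      qed simp
    qed
    then have "plus_conn (- block p) c x" using plus_conn_mono[OF sub] by blast
    moreover have "plus_conn (- block p) x u"
      using xu sub U by (intro plus_conn_adj) auto
    ultimately show ?thesis using xu(2) plus_conn_trans[of "- block p" c x u] by blast
  qed (use plus_conn_refl in blast)
  obtain u where u: "u \<in> U" "plus_conn (- block p) a u" using reach[OF assms(2)] by blast
  obtain v where v: "v \<in> U" "plus_conn (- block p) b v" using reach[OF assms(3)] by blast
  have "plus_conn (- block p) u v" using connected[OF u(1) v(1)] plus_conn_mono[OF U] by blast
  then show ?thesis using plus_conn_trans[OF plus_conn_trans[OF u(2)] plus_conn_sym[OF v(2)]] by blast
qed

text \<open>Membership in \<open>A\<close> is constant on the block and constant on
  \<open>U\<close>. Every rim edge has one side in each, so one edge in \<open>sq_boundary A\<close>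
  forces all of them.\<close>

lemma boundary_contains_rim:
  assumes A: "sq_boundary A \<subseteq> sq_boundary (- U)" and p: "p \<notin> U"
    and e: "e \<in> sq_boundary A" "e \<in> rim p"
  shows "rim p \<subseteq> sq_boundary A"
proof
  have inner: "x \<in> A \<longleftrightarrow> y \<in> A" if "x \<in> block p" "y \<in> block p" for x y
  proof (rule plus_conn_same_side)
    show "plus_conn (- U) x y"
      using plus_conn_trans[OF plus_conn_sym[of "- U" p x], of y] that by (simp add: block_def)
    fix x y e assume "x \<in> - U" "y \<in> - U" "x \<noteq> y" "e \<in> sides x" "e \<in> sides y"
    then show "e \<notin> sq_boundary A" using A in_sq_boundary_iff[of e x y "- U"] by blast
  qed
  have outer: "x \<in> A \<longleftrightarrow> y \<in> A" if "x \<in> U" "y \<in> U" for x y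
  proof (rule plus_conn_same_side)
    show "plus_conn U x y" using connected that by blast
    fix x y e assume "x \<in> U" "y \<in> U" "x \<noteq> y" "e \<in> sides x" "e \<in> sides y"
    then show "e \<notin> sq_boundary A" using A in_sq_boundary_iff[of e x y "- U"] by blast
  qed
  fix f assume f: "f \<in> rim p"
  obtain a b where ab: "a \<in> block p" "b \<in> U" "e \<in> sides a" "e \<in> sides b" using rimE[OF p e(2)] by metis
  obtain c d where cd: "c \<in> block p" "d \<in> U" "f \<in> sides c" "f \<in> sides d" using rimE[OF p f] by metis
  have "a \<noteq> b" "c \<noteq> d" using ab cd block_subset[OF p] by blast+
  then have "(a \<in> A) \<noteq> (b \<in> A)" using e(1) in_sq_boundary_iff[OF ab(3,4)] by blast
  then have "(c \<in> A) \<noteq> (d \<in> A)" using inner[OF ab(1) cd(1)] outer[OF ab(2) cd(2)] by blast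
  then show "f \<in> sq_boundary A" using in_sq_boundary_iff[OF cd(3,4) \<open>c \<noteq> d\<close>] by blast
qed

lemma even_contains_rim:
  assumes "even_graph Z" "Z \<subseteq> sq_boundary (- U)" "p \<notin> U" "e \<in> Z" "e \<in> rim p"
  shows "rim p \<subseteq> Z"
proof -
  have "finite Z" "Z \<subseteq> lattice_edges"
    using assms(2) finite_boundary sq_boundary_subset finite_subset by blast+
  then obtain A where "sq_boundary A = Z" using even_graph_is_boundary assms(1) by metis
  then show ?thesis using boundary_contains_rim[of A p e] assms by blast
qed

text \<open>The rim is even, so it contains a cycle; that cycle is itself even and therefore
  contains the whole rim.\<close>

lemma rim_is_cycle:
  assumes "p \<notin> U"
  shows "is_cycle edges (rim p)"
proof -
  have "finite (rim p)" using finite_sq_boundary finite_block[OF assms] by (simp add: rim_def)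
  moreover have "even_graph (rim p)" by (simp add: rim_def even_sq_boundary)
  moreover have "card e = 2" if "e \<in> rim p" for e
    using that card_lattice_edge sq_boundary_subset unfolding rim_def by blast
  ultimately obtain Z where Z: "is_cycle (rim p) Z"
    using even_graph_contains_cycle rim_nonempty[OF assms] by metis
  have sub: "Z \<subseteq> rim p" using is_cycle_subset[OF Z] .
  obtain e where "e \<in> Z" using is_cycle_nonempty[OF Z] by auto
  then have "rim p \<subseteq> Z"
    using even_contains_rim[OF is_cycle_even[OF Z] _ assms] sub rim_subset_boundary[OF assms] by blast
  then show ?thesis using Z sub is_cycle_mono rim_subset_edges[OF assms] by (metis subset_antisym)
qed

lemma cycle_in_boundary_is_rim:
  assumes "is_cycle E Z" "Z \<subseteq> sq_boundary (- U)" "p \<notin> U" "e \<in> Z" "e \<in> rim p"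
  shows "Z = rim p"
  using even_subset_cycle[OF assms(1), of "rim p"] even_contains_rim[OF is_cycle_even[OF assms(1)] assms(2-5)]
    rim_nonempty[OF assms(3)] even_sq_boundary unfolding rim_def by blast

lemma rims_share_at_most_one_vertex:
  assumes "p \<notin> U" "q \<notin> U" "rim p \<noteq> rim q"
  shows "card (\<Union>(rim p) \<inter> \<Union>(rim q)) \<le> 1"
proof (rule ccontr)
  assume "\<not> card (\<Union>(rim p) \<inter> \<Union>(rim q)) \<le> 1"
  then have "Suc (Suc 0) \<le> card (\<Union>(rim p) \<inter> \<Union>(rim q))" by simp
  then obtain v w B where "\<Union>(rim p) \<inter> \<Union>(rim q) = insert v (insert w B)" "v \<notin> insert w B"
    unfolding card_le_Suc_iff by metis
  then have vw: "v \<noteq> w" "v \<in> \<Union>(rim p)" "v \<in> \<Union>(rim q)" "w \<in> \<Union>(rim p)" "w \<in> \<Union>(rim q)"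
    by blast+
  obtain P where P: "P \<subseteq> rim p" "\<And>z. odd (card {e \<in> P. z \<in> e}) \<longleftrightarrow> z = v \<or> z = w"
    using cycle_arc[OF rim_is_cycle[OF assms(1)] vw(2,4,1)] by blast
  obtain Q where Q: "Q \<subseteq> rim q" "\<And>z. odd (card {e \<in> Q. z \<in> e}) \<longleftrightarrow> z = v \<or> z = w"
    using cycle_arc[OF rim_is_cycle[OF assms(2)] vw(3,5,1)] by blast
  have disj: "rim p \<inter> rim q = {}" using rim_disjoint assms by blast
  have sub: "P \<union> Q \<subseteq> sq_boundary (- U)" using P(1) Q(1) rim_subset_boundary assms(1,2) by blast
  then have fin: "finite P" "finite Q" using finite_boundary finite_subset by blast+
  \<comment> \<open>The arcs are edge-disjoint, so degrees add; both are odd exactly at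
    \<open>v\<close> and \<open>w\<close>.\<close>
  have "even_graph (P \<union> Q)"
    unfolding even_graph_def
  proof
    fix z
    have "{e \<in> P \<union> Q. z \<in> e} = {e \<in> P. z \<in> e} \<union> {e \<in> Q. z \<in> e}" by blast
    moreover have "{e \<in> P. z \<in> e} \<inter> {e \<in> Q. z \<in> e} = {}" using disj P(1) Q(1) by blast
    ultimately have "card {e \<in> P \<union> Q. z \<in> e} = card {e \<in> P. z \<in> e} + card {e \<in> Q. z \<in> e}"
      using fin by (simp add: card_Un_disjoint)
    then show "even (card {e \<in> P \<union> Q. z \<in> e})" using P(2)[of z] Q(2)[of z] by auto
  qed
  moreover have "P \<noteq> {}" using P(2)[of v] by auto
  then obtain e where "e \<in> P" by auto
  ultimately have "rim p \<subseteq> P \<union> Q" using even_contains_rim[OF _ sub assms(1)] P(1) by blast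
  \<comment> \<open>The rim of \<open>p\<close> is disjoint from \<open>Q\<close>. This makes
    \<open>P\<close> even, although its degree at \<open>v\<close> is odd.\<close>
  then have "rim p = P" using P(1) Q(1) disj by blast
  then have "even_graph P" using even_sq_boundary unfolding rim_def by metis
  then show False using P(2)[of v] unfolding even_graph_def by blast
qed

lemma interior_subset_cyc_interior:
  assumes "p \<notin> U" "q \<in> block p"
  shows "interior (square q) \<subseteq> cyc_interior (rim p)"
proof
  fix z assume "z \<in> interior (square q)"
  then have "z \<in> square q" "z \<notin> curve (sq_boundary (block p))"
    using interior_subset interior_square_disjoint_curve[OF sq_boundary_subset] by blast+
  then show "z \<in> cyc_interior (rim p)"
    unfolding cyc_interior_def rim_def using in_inside_curve[OF finite_block[OF assms(1)] assms(2)] by blast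
qed

lemma interior_subset_cyc_exterior:
  assumes "p \<notin> U" "q \<notin> block p"
  shows "interior (square q) \<subseteq> cyc_exterior (rim p)"
proof
  fix z assume "z \<in> interior (square q)"
  then have "z \<in> square q" "z \<notin> curve (sq_boundary (block p))"
    using interior_subset interior_square_disjoint_curve[OF sq_boundary_subset] by blast+
  then show "z \<in> cyc_exterior (rim p)"
    unfolding cyc_exterior_def rim_def
    using compl_square_in_outside[OF finite_block[OF assms(1)] compl_block_connected[OF assms(1)] assms(2)] by blast
qed

text \<open>A common interior point would lie in squares of two different blocks, hence on the
  boundary curve between them.\<close>

lemma cyc_interiors_disjoint:
  assumes "p \<notin> U" "q \<notin> U" "rim p \<noteq> rim q"
  shows "cyc_interior (rim p) \<inter> cyc_interior (rim q) = {}"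
proof (rule ccontr)
  assume "\<not> ?thesis"
  then obtain z where z: "z \<in> inside (curve (sq_boundary (block p)))" "z \<in> inside (curve (sq_boundary (block q)))"
    unfolding cyc_interior_def rim_def by blast
  obtain a where a: "a \<in> block p" "z \<in> square a"
    using z(1) inside_curve_subset[OF finite_block[OF assms(1)] compl_block_connected[OF assms(1)]] by blast
  obtain b where b: "b \<in> block q" "z \<in> square b"
    using z(2) inside_curve_subset[OF finite_block[OF assms(2)] compl_block_connected[OF assms(2)]] by blast
  have "block p \<noteq> block q" using assms(3) by (auto simp: rim_def)
  then have "b \<notin> block p" using b(1) block_eq by metis
  then have "z \<in> curve (sq_boundary (block p))" using squares_cross_boundary[OF a(1) _ a(2) b(2)] by blast
  then show False using z(1) inside_no_overlap by blast
qed

text \<open>Identifies the outermost boundary. From left to right, infinity is reached through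
  \<open>U\<close>; from right to left, the rim around a square of \<open>C\<close> serves as the
  test cycle.\<close>

lemma boundary_eq_outermost:
  "sq_boundary (- U) =
    {e \<in> edges. \<forall>K. is_cycle edges K \<longrightarrow> e \<in> K \<or> open_seg e \<subseteq> cyc_exterior K}"
proof (intro equalityI subsetI CollectI conjI allI impI)
  fix e assume "e \<in> sq_boundary (- U)"
  then obtain p where p: "p \<notin> U" "e \<in> rim p" using boundary_Union_rims by auto
  then obtain a b where ab: "a \<in> C" "b \<in> U" "e \<in> sides a" "e \<in> sides b" using rimE by metis
  then show "e \<in> edges" by blast
  fix K assume K: "is_cycle edges K"
  have lat: "K \<subseteq> lattice_edges" using is_cycle_subset[OF K] sides_subset_lattice_edges by blast
  show "e \<in> K \<or> open_seg e \<subseteq> cyc_exterior K"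
  proof (cases "e \<in> K")
    case False
    then have off: "open_seg e \<inter> curve K = {}"
      using open_seg_disjoint_curve[OF lat] ab(3) sides_subset_lattice_edges by blast
    have "open_seg e \<subseteq> cyc_exterior K"
      unfolding cyc_exterior_def
    proof
      fix z assume z: "z \<in> open_seg e"
      show "z \<in> outside (curve K)"
      proof (rule in_outside_curve[OF lat infinite_U connected _ ab(2)])
        show "z \<in> square b" using open_seg_subset_square[OF ab(4)] z by blast
        show "z \<notin> curve K" using off z by blast
        fix x y f assume f: "x \<in> U" "y \<in> U" "x \<noteq> y" "f \<in> sides x" "f \<in> sides y"
        show "f \<notin> K"
        proof
          \<comment> \<open>Every edge of \<open>K\<close> is a side of a square of
            \<open>C\<close>, so it cannot separate two squares of \<open>U\<close>.\<close>
          assume "f \<in> K"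
          then obtain c where "c \<in> C" "f \<in> sides c" using is_cycle_subset[OF K] by blast
          then show False using sides_unique[OF f(4,5,3)] f(1,2) disjoint by blast
        qed
      qed
    qed
    then show ?thesis ..
  qed simp
next
  fix e assume e: "e \<in> {e \<in> edges. \<forall>K. is_cycle edges K \<longrightarrow> e \<in> K \<or> open_seg e \<subseteq> cyc_exterior K}"
  then obtain p where p: "p \<in> C" "e \<in> sides p" by blast
  then have pU: "p \<notin> U" using disjoint by blast
  have "e \<in> rim p"
  proof (rule ccontr)
    assume "e \<notin> rim p"
    then have ext: "open_seg e \<subseteq> outside (curve (rim p))"
      using e rim_is_cycle[OF pU] unfolding cyc_exterior_def by blast
    obtain z where z: "z \<in> open_seg e" using open_seg_nonempty p(2) sides_subset_lattice_edges by blast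
    then have out: "z \<in> outside (curve (rim p))" using ext by blast
    then have "z \<notin> curve (rim p)" using outside_no_overlap by blast
    \<comment> \<open>A side of \<open>p\<close> that is not on the rim runs inside it, contrary to
      \<open>ext\<close>.\<close>
    then have "z \<in> inside (curve (rim p))"
      using in_inside_curve[OF finite_block[OF pU] self_in_block] open_seg_subset_square[OF p(2)] z
      unfolding rim_def by blast
    then show False using out inside_Int_outside by blast
  qed
  then show "e \<in> sq_boundary (- U)" using rim_subset_boundary[OF pU] by blast
qed

text \<open>With different rims, each square lies outside the block of the other, so their common
  corner is a vertex of both rims.\<close>

lemma star_adj_rims_meet:
  assumes "p \<in> C" "q \<in> C" "star_adj p q" "rim p \<noteq> rim q"
  shows "\<Union>(rim p) \<inter> \<Union>(rim q) \<noteq> {}"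
proof -
  obtain m n where mn: "lattice_pt m n \<in> square p" "lattice_pt m n \<in> square q"
    using star_adj_common_corner[OF assms(3)] .
  have "q \<notin> block p" "p \<notin> block q" using assms(4) block_eq unfolding rim_def by metis+
  then have "lattice_pt m n \<in> \<Union>(rim p)" "lattice_pt m n \<in> \<Union>(rim q)"
    unfolding rim_def using common_corner_in_boundary[OF mn self_in_block] common_corner_in_boundary[OF mn(2,1) self_in_block]
    by blast+
  then show ?thesis by blast
qed

text \<open>Along a star-path in \<open>C\<close> from \<open>r\<close>, consecutive rims coincide
  or share a vertex, and each rim is connected as a cycle.\<close>

lemma rims_connected:
  assumes root: "r \<in> C" and star: "\<And>p. p \<in> C \<Longrightarrow> (\<lambda>a b. a \<in> C \<and> b \<in> C \<and> star_adj a b)\<^sup>*\<^sup>* r p"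
  shows "edges_connected (sq_boundary (- U))"
proof -
  let ?R = "(\<lambda>x y. {x, y} \<in> sq_boundary (- U))\<^sup>*\<^sup>*"
  have CU: "p \<notin> U" if "p \<in> C" for p using that disjoint by blast
  have within: "?R u v" if "p \<in> C" "u \<in> \<Union>(rim p)" "v \<in> \<Union>(rim p)" for p u v
    using is_cycle_connected[OF rim_is_cycle[OF CU[OF that(1)]] that(2,3)] rim_subset_boundary[OF CU[OF that(1)]] .
  have from_root: "\<forall>u\<in>\<Union>(rim r). \<forall>v\<in>\<Union>(rim p). ?R u v" if "p \<in> C" for p
    using star[OF that]
  proof (induction rule: rtranclp_induct)
    case base
    then show ?case using within[OF root] by blast
  next
    case (step p q)
    show ?case
    proof (cases "rim p = rim q")
      case True
      then show ?thesis using step(3) by simp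
    next
      case False
      then obtain w where w: "w \<in> \<Union>(rim p)" "w \<in> \<Union>(rim q)" using star_adj_rims_meet[of p q] step(2) by blast
      show ?thesis
      proof (intro ballI)
        fix u v assume u: "u \<in> \<Union>(rim r)" and v: "v \<in> \<Union>(rim q)"
        have "?R u w" using step(3) u w(1) by blast
        moreover have "?R w v" using within[of q] step(2) w(2) v by blast
        ultimately show "?R u v" by (rule rtranclp_trans)
      qed
    qed
  qed
  obtain w where w: "w \<in> \<Union>(rim r)" using is_cycle_has_vertex[OF rim_is_cycle[OF CU[OF root]]] .
  have sym: "?R x y \<Longrightarrow> ?R y x" for x y
    by (rule sympD[OF symp_rtranclp]) (auto simp: symp_def insert_commute)
  have reach: "?R w v" if v: "v \<in> \<Union>(sq_boundary (- U))" for v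
  proof -
    obtain p f where p: "p \<notin> U" "f \<in> rim p" "v \<in> f" using v boundary_Union_rims by auto
    \<comment> \<open>Every block contains a square of \<open>C\<close>, so the rims of squares of
      \<open>C\<close> are all the rims.\<close>
    obtain a where a: "a \<in> block p" "a \<in> C" using rimE[OF p(1,2)] by metis
    then have "rim a = rim p" using block_eq by (simp add: rim_def)
    then show ?thesis using from_root[OF a(2)] w p(2,3) by blast
  qed
  show ?thesis
    unfolding edges_connected_def
  proof (intro ballI)
    fix u v assume "u \<in> \<Union>(sq_boundary (- U))" "v \<in> \<Union>(sq_boundary (- U))"
    then show "?R u v" using rtranclp_trans[OF sym[OF reach[of u]] reach[of v]] by blast
  qed
qed

end

section \<open>The outermost boundary of the occupied component\<close>

lemma plus_adj_imp_star_adj: "plus_adj p q \<Longrightarrow> star_adj p q"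
  by (cases p; cases q) (auto simp: plus_adj_iff star_adj_def)

lemma C0_origin: "occ (0, 0) \<Longrightarrow> (0, 0) \<in> C0 occ"
  by (auto simp: C0_def intro!: exI[of _ "[(0, 0)]"])

lemma C0_pathE:
  assumes "p \<in> C0 occ"
  obtains ys where "ys \<noteq> []" "distinct ys" "hd ys = (0, 0)" "last ys = p" "\<And>y. y \<in> set ys \<Longrightarrow> occ y"
    "\<And>i. Suc i < length ys \<Longrightarrow> star_adj (ys ! i) (ys ! Suc i)"
  using assms unfolding C0_def by (auto split: if_splits)

lemma C0_pathI:
  assumes "ys \<noteq> []" "distinct ys" "hd ys = (0, 0)" "last ys = p" "\<And>y. y \<in> set ys \<Longrightarrow> occ y"
    "\<And>i. Suc i < length ys \<Longrightarrow> star_adj (ys ! i) (ys ! Suc i)"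
  shows "p \<in> C0 occ"
proof -
  have "occ (0, 0)" "occ p" using assms(1,3,4,5) hd_in_set last_in_set by metis+
  then show ?thesis unfolding C0_def using assms by auto
qed

text \<open>The initial segment of the path up to index \<open>k\<close> is itself an admissible
  path.\<close>

lemma C0_path_nth:
  assumes "distinct ys" "hd ys = (0, 0)" "\<And>y. y \<in> set ys \<Longrightarrow> occ y"
    "\<And>i. Suc i < length ys \<Longrightarrow> star_adj (ys ! i) (ys ! Suc i)" "k < length ys"
  shows "ys ! k \<in> C0 occ"
proof (rule C0_pathI)
  show "take (Suc k) ys \<noteq> []" using assms(5) by auto
  show "distinct (take (Suc k) ys)" using assms(1) by simp
  show "hd (take (Suc k) ys) = (0, 0)" using assms(2) by simp
  show "last (take (Suc k) ys) = ys ! k" using assms(5) by (simp add: take_Suc_conv_app_nth)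
  show "\<And>y. y \<in> set (take (Suc k) ys) \<Longrightarrow> occ y" using assms(3) in_set_takeD by metis
  show "\<And>i. Suc i < length (take (Suc k) ys) \<Longrightarrow> star_adj (take (Suc k) ys ! i) (take (Suc k) ys ! Suc i)"
    using assms(4) by simp
qed

text \<open>Paths must not repeat squares: if \<open>q\<close> is already on the path to
  \<open>p\<close>, the path is cut there; otherwise \<open>q\<close> is appended.\<close>

lemma C0_star_closed:
  assumes "p \<in> C0 occ" "star_adj p q" "occ q"
  shows "q \<in> C0 occ"
proof -
  obtain ys where ys: "ys \<noteq> []" "distinct ys" "hd ys = (0, 0)" "last ys = p" "\<And>y. y \<in> set ys \<Longrightarrow> occ y"
    "\<And>i. Suc i < length ys \<Longrightarrow> star_adj (ys ! i) (ys ! Suc i)"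
    using C0_pathE[OF assms(1)] by blast
  show ?thesis
  proof (cases "q \<in> set ys")
    case True
    then obtain k where k: "k < length ys" "ys ! k = q" unfolding in_set_conv_nth by blast
    have "ys ! k \<in> C0 occ" using ys(2,3,5,6) k(1) by (rule C0_path_nth)
    then show ?thesis using k(2) by simp
  next
    case False
    show ?thesis
    proof (rule C0_pathI[of "ys @ [q]"])
      fix i assume i: "Suc i < length (ys @ [q])"
      show "star_adj ((ys @ [q]) ! i) ((ys @ [q]) ! Suc i)"
      proof (cases "Suc i < length ys")
        case True
        then show ?thesis using ys(6) by (simp add: nth_append)
      next
        case False
        then have "Suc i = length ys" using i by simp
        moreover from this have "ys ! i = p" using ys(1,4) by (metis diff_Suc_1 last_conv_nth)
        ultimately show ?thesis using assms(2) by (simp add: nth_append)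
      qed
    qed (use ys assms(3) False in auto)
  qed
qed

lemma C0_star_connected:
  assumes "p \<in> C0 occ"
  shows "(\<lambda>a b. a \<in> C0 occ \<and> b \<in> C0 occ \<and> star_adj a b)\<^sup>*\<^sup>* (0, 0) p"
proof -
  obtain ys where ys: "ys \<noteq> []" "distinct ys" "hd ys = (0, 0)" "last ys = p" "\<And>y. y \<in> set ys \<Longrightarrow> occ y"
    "\<And>i. Suc i < length ys \<Longrightarrow> star_adj (ys ! i) (ys ! Suc i)"
    using C0_pathE[OF assms] by blast
  have inC: "ys ! k \<in> C0 occ" if "k < length ys" for k using ys(2,3,5,6) that by (rule C0_path_nth)
  have "(\<lambda>a b. a \<in> C0 occ \<and> b \<in> C0 occ \<and> star_adj a b)\<^sup>*\<^sup>* (0, 0) (ys ! k)" if "k < length ys" for k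
    using that
  proof (induction k)
    case 0
    then show ?case using ys(1,3) by (simp add: hd_conv_nth)
  next
    case (Suc k)
    then have "(\<lambda>a b. a \<in> C0 occ \<and> b \<in> C0 occ \<and> star_adj a b)\<^sup>*\<^sup>* (0, 0) (ys ! k)" by simp
    moreover have "ys ! k \<in> C0 occ \<and> ys ! Suc k \<in> C0 occ \<and> star_adj (ys ! k) (ys ! Suc k)"
      using inC[of k] inC[of "Suc k"] ys(6)[of k] Suc(2) by simp
    ultimately show ?case by (rule rtranclp.rtrancl_into_rtrancl)
  qed
  from this[of "length ys - 1"] show ?thesis using ys(1,4) by (simp add: last_conv_nth)
qed

theorem theorem1:
  fixes occ :: "int \<times> int \<Rightarrow> bool"
  assumes S0_occ: "occ (0, 0)"
    and fin: "finite (C0 occ)"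
  shows "(\<exists>!F. finite F \<and> (\<forall>K\<in>F. is_cycle (GC_edges occ) K) \<and>
            \<Union>F = outer_boundary occ \<and>
            edges_connected (\<Union>F) \<and>
            (\<forall>K1\<in>F. \<forall>K2\<in>F. K1 \<noteq> K2 \<longrightarrow>
               cyc_interior K1 \<inter> cyc_interior K2 = {} \<and> card (\<Union>K1 \<inter> \<Union>K2) \<le> 1) \<and>
            (\<forall>p\<in>C0 occ. \<exists>K\<in>F. interior (square p) \<subseteq> cyc_interior K) \<and>
            (\<forall>K\<in>F. \<forall>e\<in>K. \<exists>p q. p \<in> C0 occ \<and> \<not> occ q \<and> e \<in> sides p \<and> e \<in> sides q \<and>
               interior (square p) \<subseteq> cyc_interior K \<and> interior (square q) \<subseteq> cyc_exterior K))
         \<and> (\<exists>ws. is_circuit_list (GC_edges occ) ws \<and> outer_boundary occ \<subseteq> closed_walk_edges ws)"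
proof -
  obtain U where U: "U \<inter> C0 occ = {}" "finite (- U)" "\<And>p q. p \<in> U \<Longrightarrow> q \<in> U \<Longrightarrow> plus_conn U p q"
    "\<And>p q. p \<in> U \<Longrightarrow> plus_adj p q \<Longrightarrow> q \<notin> C0 occ \<Longrightarrow> q \<in> U"
    using exterior_region_exists[OF fin] by metis
  interpret exterior_region "C0 occ" U
    by unfold_locales (use U in auto)
  have origin: "(0, 0) \<in> C0 occ" using C0_origin[of occ] S0_occ by blast
  \<comment> \<open>Squares of the same block give the same rim, so this family has one cycle for
    each \<open>D\<^sub>i\<close>.\<close>
  define F where "F = rim ` (- U)"
  have finF: "finite F" unfolding F_def using finite_compl by blast
  have cycF: "is_cycle (GC_edges occ) K" if "K \<in> F" for K
    using that rim_is_cycle unfolding F_def GC_edges_def by blast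
  have outer: "outer_boundary occ = sq_boundary (- U)"
    unfolding outer_boundary_def GC_edges_def boundary_eq_outermost ..
  have UF: "\<Union>F = outer_boundary occ"
    unfolding F_def outer boundary_Union_rims ..
  have conn: "edges_connected (\<Union>F)"
    unfolding UF outer using rims_connected[OF origin C0_star_connected] by blast
  have disj: "K \<inter> K' = {}" if "K \<in> F" "K' \<in> F" "K \<noteq> K'" for K K'
    using that rim_disjoint unfolding F_def by blast
  have sep: "cyc_interior K1 \<inter> cyc_interior K2 = {} \<and> card (\<Union>K1 \<inter> \<Union>K2) \<le> 1"
    if K: "K1 \<in> F" "K2 \<in> F" "K1 \<noteq> K2" for K1 K2
  proof -
    obtain p q where "p \<notin> U" "K1 = rim p" "q \<notin> U" "K2 = rim q" using K(1,2) unfolding F_def by blast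
    then show ?thesis using cyc_interiors_disjoint[of p q] rims_share_at_most_one_vertex[of p q] K(3) by blast
  qed
  have cover: "\<exists>K\<in>F. interior (square p) \<subseteq> cyc_interior K" if "p \<in> C0 occ" for p
  proof -
    have "p \<notin> U" using that disjoint by blast
    then show ?thesis using interior_subset_cyc_interior[OF _ self_in_block] unfolding F_def by blast
  qed
  have bdry: "\<exists>p q. p \<in> C0 occ \<and> \<not> occ q \<and> e \<in> sides p \<and> e \<in> sides q \<and>
      interior (square p) \<subseteq> cyc_interior K \<and> interior (square q) \<subseteq> cyc_exterior K"
    if K: "K \<in> F" "e \<in> K" for K e
  proof -
    obtain r where r: "r \<notin> U" "K = rim r" using K(1) unfolding F_def by blast
    obtain p q where pq: "p \<in> block r" "p \<in> C0 occ" "q \<in> U" "plus_adj p q" "e \<in> sides p" "e \<in> sides q"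
      using rimE[OF r(1)] K(2) r(2) by metis
    \<comment> \<open>An occupied \<open>q\<close> would be star-adjacent to \<open>p\<close> and so
      belong to \<open>C0 occ\<close>, which \<open>U\<close> avoids.\<close>
    have "\<not> occ q"
      using C0_star_closed[OF pq(2) plus_adj_imp_star_adj[OF pq(4)]] pq(3) disjoint by blast
    moreover have "q \<notin> block r" using pq(3) block_subset[OF r(1)] by blast
    ultimately show ?thesis
      using pq interior_subset_cyc_interior[OF r(1) pq(1)] interior_subset_cyc_exterior[OF r(1)] r(2) by blast
  qed
  have uniq: "G = F" if G: "\<forall>K\<in>G. is_cycle (GC_edges occ) K" "\<Union>G = outer_boundary occ" for G
  proof -
    \<comment> \<open>Cycles of the two families that share an edge coincide. As both families have
      the same union and consist of nonempty cycles, they are equal.\<close>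
    have K: "Z = K" if ZK: "Z \<in> G" "K \<in> F" "e \<in> Z" "e \<in> K" for Z K e
    proof -
      obtain r where r: "r \<notin> U" "K = rim r" using ZK(2) unfolding F_def by blast
      have "is_cycle (GC_edges occ) Z" using G(1) ZK(1) by blast
      moreover have "Z \<subseteq> sq_boundary (- U)" using G(2) ZK(1) outer by blast
      ultimately show ?thesis using cycle_in_boundary_is_rim[OF _ _ r(1)] ZK(3,4) r(2) by blast
    qed
    have ne: "\<exists>e. e \<in> K" if "K \<in> F \<or> K \<in> G" for K
      using that is_cycle_nonempty cycF G(1) by blast
    have UG: "\<Union>G = \<Union>F" using G(2) UF by simp
    show ?thesis
    proof (intro equalityI subsetI)
      fix Z assume Z: "Z \<in> G"
      then obtain e where e: "e \<in> Z" using ne by blast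
      then obtain K where "K \<in> F" "e \<in> K" using UG Z by blast
      then show "Z \<in> F" using K[OF Z _ e] by blast
    next
      fix K assume KF: "K \<in> F"
      then obtain e where e: "e \<in> K" using ne by blast
      then obtain Z where "Z \<in> G" "e \<in> Z" using UG KF by blast
      then show "K \<in> G" using K[OF _ KF _ e] by blast
    qed
  qed
  \<comment> \<open>The cycle enclosing the origin square is a member.\<close>
  have Fne: "F \<noteq> {}" using cover[OF origin] by blast
  have circuit: "\<exists>ws. is_circuit_list (GC_edges occ) ws \<and> outer_boundary occ \<subseteq> closed_walk_edges ws"
  proof -
    obtain ws where "is_circuit_list (GC_edges occ) ws" "closed_walk_edges ws = \<Union>F"
      using finF Fne cycF disj conn by (rule circuit_of_connected_cycles)
    then show ?thesis unfolding UF by blast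
  qed
  show ?thesis
  proof (intro conjI ex1I[of _ F] circuit finF UF conn)
    show "\<forall>K\<in>F. is_cycle (GC_edges occ) K" using cycF by blast
    show "\<forall>K1\<in>F. \<forall>K2\<in>F. K1 \<noteq> K2 \<longrightarrow>
        cyc_interior K1 \<inter> cyc_interior K2 = {} \<and> card (\<Union>K1 \<inter> \<Union>K2) \<le> 1"
      using sep by (intro ballI impI)
    show "\<forall>p\<in>C0 occ. \<exists>K\<in>F. interior (square p) \<subseteq> cyc_interior K" using cover by (intro ballI)
    show "\<forall>K\<in>F. \<forall>e\<in>K. \<exists>p q. p \<in> C0 occ \<and> \<not> occ q \<and> e \<in> sides p \<and> e \<in> sides q \<and>
        interior (square p) \<subseteq> cyc_interior K \<and> interior (square q) \<subseteq> cyc_exterior K"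
      using bdry by (intro ballI)
  qed (elim conjE, rule uniq)
qed

end
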